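(* For every $s\in \mathbb{N}$ and $\bm{k} \in \mathbb{N}^s$, we have $F(n;\bm{k})=2^{Q(\bm{k})\binom{n}{2}+o(n^2)}$ as $n\to\infty$; equivalently, the limit $\lim_{n\to\infty} \frac{\log_2 F(n;\bm{k})}{n^2/2}$ exists and equals $Q(\bm{k})$.
   Context: For $s\in\mathbb{N}$ write $[s]=\{1,\dots,s\}$. For $\bm{k}=(k_1,\dots,k_s)\in\mathbb{N}^s$, an $s$-edge-colouring $\sigma:E(G)\to[s]$ of a graph $G$ (not necessarily proper) is $\bm{k}$-valid if for each $c\in[s]$ the colour-$c$ subgraph $\sigma^{-1}(c)$ contains no copy of $K_{k_c}$; $F(G;\bm{k})$ is the number of $\bm{k}$-valid colourings of $G$, and $F(n;\bm{k})$ is the maximum of $F(G;\bm{k})$ over all $n$-vertex graphs $G$. The Ramsey number $R(\bm{k})$ is the minimum $R$ such that $K_R$ admits no $\bm{k}$-valid $s$-edge-colouring. For $t\in\{0,1,2\}$ and $r\in\mathbb{N}$, $\Phi_t(r;\bm{k})$ is the set of functions $\phi:\binom{[r]}{2}\to 2^{[s]}$ such that for every $c\in[s]$ the graph on $[r]$ with edge set $\phi^{-1}(c)=\{ij : c\in\phi(ij)\}$ is $K_{k_c}$-free, and $|\phi(ij)|\ge t$ for all $ij\in\binom{[r]}{2}$. $\Delta^r$ is the set of $\bm{\alpha}=(\alpha_1,\dots,\alpha_r)\in\mathbb{R}^r$ with all $\alpha_i\ge 0$ and $\sum_i\alpha_i=1$. The feasible set $\mathrm{FEAS}_t(\bm{k})$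 consists of triples $(r,\phi,\bm{\alpha})$ with $r\in\mathbb{N}$, $r<R(\bm{k})$, $\phi\in\Phi_t(r;\bm{k})$, $\bm{\alpha}\in\Delta^r$. Define $q(r,\phi,\bm{\alpha}) = 2\sum_{1\le i<j\le r,\ \phi(ij)\neq\emptyset}\alpha_i\alpha_j\log_2|\phi(ij)|$ and $Q_t(\bm{k})=\max_{(r,\phi,\bm{\alpha})\in\mathrm{FEAS}_t(\bm{k})} q(r,\phi,\bm{\alpha})$. Here $Q(\bm{k})$ denotes $Q_0(\bm{k})$ (which the paper shows equals $Q_1(\bm{k})$ and $Q_2(\bm{k})$). *)

theory Defs
  imports
    "HOL-Analysis.Analysis"
    "HOL-Library.Ramsey"
    "HOL-Library.Landau_Symbols"
begin

text \<open>
  A finite simple graph is given by a vertex set \<open>V\<close> and an edge set \<open>E \<subseteq> [V]\<^bsup>2\<^esup>\<close>, where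
  \<open>[V]\<^bsup>2\<^esup>\<close> is the set of two-element subsets of \<open>V\<close>. A tuple \<open>(k\<^sub>1, \<dots>, k\<^sub>s)\<close> is a
  function \<open>k\<close> together with its length \<open>s\<close>; only the values \<open>k 1, \<dots>, k s\<close> are ever used.
\<close>

definition contains_clique :: "'a set \<Rightarrow> 'a set set \<Rightarrow> nat \<Rightarrow> bool" where
  "contains_clique V E m \<longleftrightarrow> (\<exists>H \<in> [V]\<^bsup>m\<^esup>. [H]\<^bsup>2\<^esup> \<subseteq> E)"

text \<open>
  Colourings and the functions in \<open>Phi\<close> are extensional (\<open>\<rightarrow>\<^sub>E\<close>), so that each one is
  represented by exactly one HOL function and they can be counted with \<^const>\<open>card\<close>.
\<close>

definition valid_colourings ::
  "nat \<Rightarrow> (nat \<Rightarrow> nat) \<Rightarrow> 'a set \<Rightarrow> 'a set set \<Rightarrow> ('a set \<Rightarrow> nat) set" where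
  "valid_colourings s k V E =
     {\<sigma> \<in> E \<rightarrow>\<^sub>E {1..s}. \<forall>c \<in> {1..s}. \<not> contains_clique V {e \<in> E. \<sigma> e = c} (k c)}"

definition F_graph :: "nat \<Rightarrow> (nat \<Rightarrow> nat) \<Rightarrow> 'a set \<Rightarrow> 'a set set \<Rightarrow> nat" where
  "F_graph s k V E = card (valid_colourings s k V E)"

text \<open>
  The number of valid colourings is invariant under isomorphism, so the maximum over all
  \<open>n\<close>-vertex graphs is taken over the graphs with vertex set \<open>{1..n}\<close>.
\<close>

definition F_max :: "nat \<Rightarrow> (nat \<Rightarrow> nat) \<Rightarrow> nat \<Rightarrow> nat" where
  "F_max s k n = Max (F_graph s k {1..n} ` Pow ([{1..n}]\<^bsup>2\<^esup>))"

definition ramsey_number :: "nat \<Rightarrow> (nat \<Rightarrow> nat) \<Rightarrow> nat" where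
  "ramsey_number s k = (LEAST R. valid_colourings s k {1..R} ([{1..R}]\<^bsup>2\<^esup>) = {})"

definition Phi :: "nat \<Rightarrow> nat \<Rightarrow> nat \<Rightarrow> (nat \<Rightarrow> nat) \<Rightarrow> (nat set \<Rightarrow> nat set) set" where
  "Phi t r s k =
     {\<phi> \<in> [{1..r}]\<^bsup>2\<^esup> \<rightarrow>\<^sub>E Pow {1..s}.
        (\<forall>c \<in> {1..s}. \<not> contains_clique {1..r} {e \<in> [{1..r}]\<^bsup>2\<^esup>. c \<in> \<phi> e} (k c)) \<and>
        (\<forall>e \<in> [{1..r}]\<^bsup>2\<^esup>. t \<le> card (\<phi> e))}"

definition unit_simplex :: "nat \<Rightarrow> (nat \<Rightarrow> real) set" where
  "unit_simplex r = {\<alpha> \<in> {1..r} \<rightarrow>\<^sub>E {0..}. (\<Sum>i = 1..r. \<alpha> i) = 1}"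

definition FEAS ::
  "nat \<Rightarrow> nat \<Rightarrow> (nat \<Rightarrow> nat) \<Rightarrow> (nat \<times> (nat set \<Rightarrow> nat set) \<times> (nat \<Rightarrow> real)) set" where
  "FEAS t s k =
     {(r, \<phi>, \<alpha>). 1 \<le> r \<and> r < ramsey_number s k \<and> \<phi> \<in> Phi t r s k \<and> \<alpha> \<in> unit_simplex r}"

definition q :: "nat \<times> (nat set \<Rightarrow> nat set) \<times> (nat \<Rightarrow> real) \<Rightarrow> real" where
  "q = (\<lambda>(r, \<phi>, \<alpha>).
     2 * (\<Sum>(i, j) \<in> {(i, j). 1 \<le> i \<and> i < j \<and> j \<le> r \<and> \<phi> {i, j} \<noteq> {}}.
            \<alpha> i * \<alpha> j * log 2 (real (card (\<phi> {i, j})))))"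

text \<open>
  \<open>FEAS t s k\<close> is infinite in general, so \<^const>\<open>Max\<close> is not applicable; \<^const>\<open>Greatest\<close>
  denotes the attained maximum.
\<close>

definition Q :: "nat \<Rightarrow> nat \<Rightarrow> (nat \<Rightarrow> nat) \<Rightarrow> real" where
  "Q t s k = (GREATEST x. x \<in> q ` FEAS t s k)"

end

theory Submission
  imports Defs
begin

text \<open>
  Lower bound: map the \<open>n\<close> vertices at random to the vertices of an optimal weighted pattern
  \<open>(r, \<phi>, \<alpha>)\<close>, with probabilities \<open>\<alpha>\<close>, and let each pair use exactly the colours that \<open>\<phi>\<close> allows for
  its image. The expected logarithm of the number of colourings obtained is \<open>Q (n choose 2)\<close>.

  Upper bound: by weak (Frieze-Kannan) regularity every valid colouring has a vertex partition with
  boundedly many parts that is regular for all colours at once. Let the template of the colouring be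
  the set of colours that are dense between two parts. There are only \<open>2\<^bsup>O(n)\<^esup>\<close> templates, and a colouring
  leaves its template on few edges. Cut-norm counting shows that a template contains few forbidden
  cliques, so it pulls back to a clique-free pattern along most \<open>m\<close>-tuples of vertices. The
  Motzkin-Straus argument bounds such a pattern by \<open>Q\<close>; averaging over the tuples bounds the template,
  and hence the number of colourings near it, by \<open>2\<^bsup>(Q + o(1)) n\<^sup>2 / 2\<^esup>\<close>.
\<close>

section \<open>Product expectations and conditional expectations\<close>

text \<open>The template of a colouring is never made clique-free, so there is no removal lemma.
  Since \<open>lagr_le_Q\<close> bounds patterns on any finite number of vertices, it suffices that
  a random m-tuple of vertices pulls the template back to a clique-free pattern with probability
  close to 1. The price is a factor m / (m - 1), because a Lagrangian on m vertices omits the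
  diagonal, and the probability of a bad tuple. Sampling vertices rather than parts also takes care
  of colours that are dense inside a single part.

  Counting in cut norm loses \<epsilon> / \<delta> ^ m^2, up to factors in m and s. This is harmless
  because \<epsilon> is chosen after \<delta> and m, and it is why weak regularity, with its error
  \<epsilon> n^2 over all blocks together, is strong enough.

  The restriction r < R(k) does not weaken the upper bound: merging vertices whose pair has at most
  one colour leaves a support in which every pair has at least two, and choosing one colour per pair
  gives a valid colouring of a complete graph.\<close>

lemma sum_distinct_pairs_insert:
  fixes f :: "'a \<Rightarrow> 'a \<Rightarrow> 'b::comm_monoid_add"
  assumes "finite K" "v \<notin> K"
  shows "(\<Sum>x\<in>insert v K. \<Sum>y\<in>insert v K - {x}. f x y)
       = (\<Sum>x\<in>K. \<Sum>y\<in>K - {x}. f x y) + (\<Sum>y\<in>K. f v y + f y v)"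
proof -
  have "(\<Sum>y\<in>insert v K - {x}. f x y) = f x v + (\<Sum>y\<in>K - {x}. f x y)" if "x \<in> K" for x
  proof -
    have "insert v K - {x} = insert v (K - {x})" using assms that by auto
    then show ?thesis using assms by simp
  qed
  moreover have "insert v K - {v} = K" using assms by auto
  ultimately show ?thesis using assms by (simp add: sum.distrib ac_simps)
qed

lemma sum_unordered_pairs:
  fixes h :: "'a set \<Rightarrow> 'b::comm_semiring_1"
  assumes "finite V"
  shows "(\<Sum>x\<in>V. \<Sum>y\<in>V - {x}. h {x, y}) = 2 * sum h ([V]\<^bsup>2\<^esup>)"
  using assms
proof (induction V)
  case empty
  then show ?case by (simp add: nsets_2_eq)
next
  case (insert v V)
  have ns: "[insert v V]\<^bsup>2\<^esup> = [V]\<^bsup>2\<^esup> \<union> (\<lambda>y. {v, y}) ` V"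
    using insert.hyps by (auto simp: nsets_2_eq)
  have inj: "inj_on (\<lambda>y. {v, y}) V"
    using insert.hyps by (auto simp: inj_on_def doubleton_eq_iff)
  have "sum h ([insert v V]\<^bsup>2\<^esup>) = sum h ([V]\<^bsup>2\<^esup>) + (\<Sum>y\<in>V. h {v, y})"
    unfolding ns using insert.hyps
    by (subst sum.union_disjoint) (auto simp: finite_imp_finite_nsets sum.reindex[OF inj] nsets_def)
  moreover have "(\<Sum>y\<in>V. h {v, y} + h {y, v}) = 2 * (\<Sum>y\<in>V. h {v, y})"
    by (simp add: insert_commute sum.distrib mult_2)
  ultimately show ?case
    unfolding sum_distinct_pairs_insert[OF insert.hyps] insert.IH
    by (simp only: distrib_left)
qed

section \<open>Expectation over independent coordinates\<close>

text \<open>Expectation of \<open>F x\<close> when the coordinates \<open>x v\<close> are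
  independent with law \<alpha>. It serves twice: with the optimal weights for the lower bound, and
  uniformly on the vertices (\<open>uexp\<close>) for counting and sampling.\<close>

definition pexp :: "'a set \<Rightarrow> 'b set \<Rightarrow> ('b \<Rightarrow> real) \<Rightarrow> (('a \<Rightarrow> 'b) \<Rightarrow> real) \<Rightarrow> real" where
  "pexp I R \<alpha> F = (\<Sum>x \<in> I \<rightarrow>\<^sub>E R. (\<Prod>v\<in>I. \<alpha> (x v)) * F x)"

lemma pexp_const:
  assumes "finite I" "finite R" "sum \<alpha> R = 1"
  shows "pexp I R \<alpha> (\<lambda>_. c) = c"
  using prod_sum_PiE[of I "\<lambda>_. R" "\<lambda>_. \<alpha>"] assms
  by (simp add: pexp_def flip: sum_distrib_right)

lemma pexp_mono:
  assumes "\<And>p. p \<in> R \<Longrightarrow> \<alpha> p \<ge> 0" "\<And>x. x \<in> I \<rightarrow>\<^sub>E R \<Longrightarrow> F x \<le> G x"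
  shows "pexp I R \<alpha> F \<le> pexp I R \<alpha> G"
  unfolding pexp_def using assms
  by (intro sum_mono mult_left_mono prod_nonneg) auto

lemma pexp_cong:
  assumes "\<And>x. x \<in> I \<rightarrow>\<^sub>E R \<Longrightarrow> F x = G x"
  shows "pexp I R \<alpha> F = pexp I R \<alpha> G"
  unfolding pexp_def using assms by (intro sum.cong) auto

lemma pexp_sum: "pexp I R \<alpha> (\<lambda>x. \<Sum>a\<in>A. F a x) = (\<Sum>a\<in>A. pexp I R \<alpha> (F a))"
  unfolding pexp_def sum_distrib_left by (rule sum.swap)

lemma pexp_cmult: "pexp I R \<alpha> (\<lambda>x. c * F x) = c * pexp I R \<alpha> F"
  unfolding pexp_def sum_distrib_left by (intro sum.cong) auto

lemma pexp_add: "pexp I R \<alpha> (\<lambda>x. F x + G x) = pexp I R \<alpha> F + pexp I R \<alpha> G"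
  unfolding pexp_def by (simp add: algebra_simps sum.distrib)

lemma pexp_insert:
  assumes "finite I" "i \<notin> I"
  shows "pexp (insert i I) R \<alpha> F = (\<Sum>p\<in>R. \<alpha> p * pexp I R \<alpha> (\<lambda>y. F (y(i := p))))"
proof -
  have "pexp (insert i I) R \<alpha> F =
      (\<Sum>(p, y)\<in>R \<times> (I \<rightarrow>\<^sub>E R). (\<Prod>v\<in>insert i I. \<alpha> ((y(i := p)) v)) * F (y(i := p)))"
    unfolding pexp_def PiE_insert_eq
    using assms inj_combinator[OF assms(2), of "\<lambda>_. R"]
    by (subst sum.reindex) (auto simp: case_prod_unfold)
  also have "\<dots> = (\<Sum>(p, y)\<in>R \<times> (I \<rightarrow>\<^sub>E R). \<alpha> p * ((\<Prod>v\<in>I. \<alpha> (y v)) * F (y(i := p))))"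
  proof (intro sum.cong refl, clarify)
    fix p y
    have "(\<Prod>v\<in>I. \<alpha> ((y(i := p)) v)) = (\<Prod>v\<in>I. \<alpha> (y v))"
      using assms by (intro prod.cong) auto
    then show "(\<Prod>v\<in>insert i I. \<alpha> ((y(i := p)) v)) * F (y(i := p)) = \<alpha> p * ((\<Prod>v\<in>I. \<alpha> (y v)) * F (y(i := p)))"
      using assms by simp
  qed
  also have "\<dots> = (\<Sum>p\<in>R. \<alpha> p * pexp I R \<alpha> (\<lambda>y. F (y(i := p))))"
    unfolding pexp_def by (simp add: sum.cartesian_product sum_distrib_left)
  finally show ?thesis .
qed

text \<open>Redrawing one coordinate does not change the joint law. This plays the part of Fubini:
  one coordinate is integrated out with the others frozen, while I stays as it is.\<close>

lemma pexp_resample: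
  assumes "finite I" "i \<in> I" "sum \<alpha> R = 1"
  shows "pexp I R \<alpha> F = pexp I R \<alpha> (\<lambda>x. \<Sum>p\<in>R. \<alpha> p * F (x(i := p)))"
proof -
  define J where "J = I - {i}"
  have I: "I = insert i J" "i \<notin> J" "finite J" using assms by (auto simp: J_def)
  \<comment> \<open>The inner update overwrites the value drawn outside, so the outer weights sum
    out to a factor 1.\<close>
  have "pexp I R \<alpha> (\<lambda>x. \<Sum>p\<in>R. \<alpha> p * F (x(i := p))) = (\<Sum>p\<in>R. \<alpha> p) * pexp J R \<alpha> (\<lambda>y. \<Sum>p\<in>R. \<alpha> p * F (y(i := p)))"
    unfolding I(1) pexp_insert[OF I(3,2)] by (simp add: sum_distrib_right)
  also have "\<dots> = pexp I R \<alpha> F"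
    unfolding I(1) pexp_insert[OF I(3,2)] using assms by (simp add: pexp_sum pexp_cmult)
  finally show ?thesis by simp
qed

lemma pexp_coordinate:
  assumes "finite I" "finite R" "i \<in> I" "sum \<alpha> R = 1"
  shows "pexp I R \<alpha> (\<lambda>x. f (x i)) = (\<Sum>p\<in>R. \<alpha> p * f p)"
  using assms by (subst pexp_resample[where i = i]) (auto simp: pexp_const)

lemma pexp_two_coordinates:
  assumes "finite I" "finite R" "i \<in> I" "j \<in> I" "i \<noteq> j" "sum \<alpha> R = 1"
  shows "pexp I R \<alpha> (\<lambda>x. f (x i) (x j)) = (\<Sum>p\<in>R. \<Sum>q\<in>R. \<alpha> p * \<alpha> q * f p q)"
proof -
  have "pexp I R \<alpha> (\<lambda>x. f (x i) (x j)) = pexp I R \<alpha> (\<lambda>x. \<Sum>q\<in>R. \<alpha> q * f (x i) q)"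
    using assms by (subst pexp_resample[where i = j]) auto
  also have "\<dots> = (\<Sum>p\<in>R. \<alpha> p * (\<Sum>q\<in>R. \<alpha> q * f p q))"
    using assms by (subst pexp_coordinate[where f = "\<lambda>p. \<Sum>q\<in>R. \<alpha> q * f p q"]) auto
  finally show ?thesis by (simp add: sum_distrib_left mult.assoc)
qed

text \<open>The average of \<open>f\<close> over the fibre of \<open>\<pi>\<close> through a point, i.e. a conditional expectation.\<close>

definition cexp :: "'w set \<Rightarrow> ('w \<Rightarrow> 'l) \<Rightarrow> ('w \<Rightarrow> real) \<Rightarrow> 'w \<Rightarrow> real" where
  "cexp \<Omega> \<pi> f w = sum f {v\<in>\<Omega>. \<pi> v = \<pi> w} / real (card {v\<in>\<Omega>. \<pi> v = \<pi> w})"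

lemma cexp_measurable: "\<pi> v = \<pi> w \<Longrightarrow> cexp \<Omega> \<pi> f v = cexp \<Omega> \<pi> f w"
  by (simp add: cexp_def)

text \<open>The point w is arbitrary: over an empty fibre the quotient is 0 / 0 = 0.\<close>

lemma cexp_nonneg: "(\<And>w. w \<in> \<Omega> \<Longrightarrow> 0 \<le> f w) \<Longrightarrow> 0 \<le> cexp \<Omega> \<pi> f w"
  by (auto simp: cexp_def intro!: divide_nonneg_nonneg sum_nonneg)

lemma cexp_le_1: "(\<And>w. w \<in> \<Omega> \<Longrightarrow> f w \<le> 1) \<Longrightarrow> cexp \<Omega> \<pi> f w \<le> 1"
  using sum_bounded_above[of "{v\<in>\<Omega>. \<pi> v = \<pi> w}" f 1]
  by (auto simp: cexp_def divide_le_eq)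

text \<open>The defining property of conditional expectation: on each fibre h is constant, and the
  average has the same sum as f.\<close>

lemma sum_cexp_mult:
  assumes "finite \<Omega>" "\<And>v w. v \<in> \<Omega> \<Longrightarrow> w \<in> \<Omega> \<Longrightarrow> \<pi> v = \<pi> w \<Longrightarrow> h v = h w"
  shows "(\<Sum>w\<in>\<Omega>. cexp \<Omega> \<pi> f w * h w) = (\<Sum>w\<in>\<Omega>. f w * h w)"
proof -
  have fib: "(\<Sum>w\<in>{w\<in>\<Omega>. \<pi> w = l}. cexp \<Omega> \<pi> f w * h w) = (\<Sum>w\<in>{w\<in>\<Omega>. \<pi> w = l}. f w * h w)" if l: "l \<in> \<pi> ` \<Omega>" for l
  proof -
    let ?A = "{w\<in>\<Omega>. \<pi> w = l}"
    obtain w0 where w0: "w0 \<in> \<Omega>" "\<pi> w0 = l" using l by auto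
    have c: "card ?A > 0" using w0 assms(1) by (auto simp: card_gt_0_iff)
    have h: "h w = h w0" if "w \<in> ?A" for w using that w0 by (intro assms(2)) auto
    have "(\<Sum>w\<in>?A. cexp \<Omega> \<pi> f w * h w) = (\<Sum>w\<in>?A. sum f ?A / real (card ?A) * h w0)"
      by (intro sum.cong refl) (auto simp: cexp_def h)
    also have "\<dots> = sum f ?A * h w0" using c by simp
    also have "\<dots> = (\<Sum>w\<in>?A. f w * h w)" unfolding sum_distrib_right by (intro sum.cong refl) (simp add: h)
    finally show ?thesis .
  qed
  show ?thesis
    using sum.group[OF assms(1) finite_imageI[OF assms(1)] subset_refl, of "\<lambda>w. cexp \<Omega> \<pi> f w * h w" \<pi>]
      sum.group[OF assms(1) finite_imageI[OF assms(1)] subset_refl, of "\<lambda>w. f w * h w" \<pi>] fib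
    by (simp add: conj_commute)
qed

text \<open>The energy of \<open>\<pi>\<close> is \<open>\<Sum>w. (cexp \<Omega> \<pi> f w)\<^sup>2\<close>; passing to a refinement it grows by the squared
  \<open>L\<^sup>2\<close> distance (Pythagoras), to which Cauchy-Schwarz is applied.\<close>

lemma energy_refine:
  assumes "finite \<Omega>"
    and ref: "\<And>v w. v \<in> \<Omega> \<Longrightarrow> w \<in> \<Omega> \<Longrightarrow> \<pi>' v = \<pi>' w \<Longrightarrow> \<pi> v = \<pi> w"
  shows "(\<Sum>w\<in>\<Omega>. (cexp \<Omega> \<pi>' f w)\<^sup>2) - (\<Sum>w\<in>\<Omega>. (cexp \<Omega> \<pi> f w)\<^sup>2)
       = (\<Sum>w\<in>\<Omega>. (cexp \<Omega> \<pi>' f w - cexp \<Omega> \<pi> f w)\<^sup>2)"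
proof -
  let ?c = "cexp \<Omega> \<pi> f" and ?c' = "cexp \<Omega> \<pi>' f"
  have "(\<Sum>w\<in>\<Omega>. ?c' w * ?c w) = (\<Sum>w\<in>\<Omega>. f w * ?c w)"
    using ref by (intro sum_cexp_mult assms(1)) (auto intro: cexp_measurable)
  also have "\<dots> = (\<Sum>w\<in>\<Omega>. ?c w * ?c w)"
    by (intro sum_cexp_mult[symmetric] assms(1)) (auto intro: cexp_measurable)
  finally have "(\<Sum>w\<in>\<Omega>. ?c' w * ?c w) = (\<Sum>w\<in>\<Omega>. (?c w)\<^sup>2)"
    by (simp add: power2_eq_square)
  moreover have "(\<Sum>w\<in>\<Omega>. (?c' w - ?c w)\<^sup>2) = (\<Sum>w\<in>\<Omega>. (?c' w)\<^sup>2) + (\<Sum>w\<in>\<Omega>. (?c w)\<^sup>2) - 2 * (\<Sum>w\<in>\<Omega>. ?c' w * ?c w)"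
    by (simp add: power2_diff sum.distrib sum_subtractf sum_distrib_left mult.assoc)
  ultimately show ?thesis by simp
qed

text \<open>Since h is constant on the fibres of \<pi>', f and its finer average correlate equally
  with h. A large correlation of the coarse error is therefore one of the difference of the two
  averages, whose squared norm is the energy gained.\<close>

lemma energy_increment:
  assumes "finite \<Omega>"
    and ref: "\<And>v w. v \<in> \<Omega> \<Longrightarrow> w \<in> \<Omega> \<Longrightarrow> \<pi>' v = \<pi>' w \<Longrightarrow> \<pi> v = \<pi> w"
    and meas: "\<And>v w. v \<in> \<Omega> \<Longrightarrow> w \<in> \<Omega> \<Longrightarrow> \<pi>' v = \<pi>' w \<Longrightarrow> h v = h w"
    and h: "\<And>w. w \<in> \<Omega> \<Longrightarrow> \<bar>h w\<bar> \<le> 1"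
    and big: "\<eta> < (\<Sum>w\<in>\<Omega>. (cexp \<Omega> \<pi> f w - f w) * h w)" and "\<eta> \<ge> 0"
  shows "\<eta>\<^sup>2 \<le> real (card \<Omega>) * ((\<Sum>w\<in>\<Omega>. (cexp \<Omega> \<pi>' f w)\<^sup>2) - (\<Sum>w\<in>\<Omega>. (cexp \<Omega> \<pi> f w)\<^sup>2))"
proof -
  let ?c = "cexp \<Omega> \<pi> f" and ?c' = "cexp \<Omega> \<pi>' f"
  have "(\<Sum>w\<in>\<Omega>. f w * h w) = (\<Sum>w\<in>\<Omega>. ?c' w * h w)"
    by (intro sum_cexp_mult[symmetric] assms(1) meas)
  then have eq: "(\<Sum>w\<in>\<Omega>. (?c w - f w) * h w) = - (\<Sum>w\<in>\<Omega>. (?c' w - ?c w) * h w)"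
    by (simp add: left_diff_distrib sum_subtractf)
  have "\<eta>\<^sup>2 \<le> (\<Sum>w\<in>\<Omega>. (?c' w - ?c w) * h w)\<^sup>2"
    using big \<open>\<eta> \<ge> 0\<close> unfolding eq by (metis less_imp_le power2_minus power_mono)
  also have "\<dots> \<le> (\<Sum>w\<in>\<Omega>. (?c' w - ?c w)\<^sup>2) * (\<Sum>w\<in>\<Omega>. (h w)\<^sup>2)"
    by (rule Cauchy_Schwarz_ineq_sum)
  also have "\<dots> \<le> (\<Sum>w\<in>\<Omega>. (?c' w - ?c w)\<^sup>2) * real (card \<Omega>)"
  proof (rule mult_left_mono)
    have "(h w)\<^sup>2 \<le> 1" if "w \<in> \<Omega>" for w using h[OF that] by (simp add: abs_square_le_1)
    then show "(\<Sum>w\<in>\<Omega>. (h w)\<^sup>2) \<le> real (card \<Omega>)"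
      using sum_bounded_above[of \<Omega> "\<lambda>w. (h w)\<^sup>2" 1] by simp
  qed (simp add: sum_nonneg)
  finally show ?thesis
    by (simp add: energy_refine[OF assms(1) ref] mult.commute)
qed

section \<open>Weak regularity\<close>

text \<open>Labelling \<open>(x, y)\<close> by the unordered pair \<open>{p x, p y}\<close> makes the averages symmetric.\<close>

definition block_density :: "'a set \<Rightarrow> ('a \<Rightarrow> nat) \<Rightarrow> ('a set \<Rightarrow> real) \<Rightarrow> 'a \<times> 'a \<Rightarrow> real" where
  "block_density V p G = cexp (V \<times> V) (\<lambda>(x, y). {p x, p y}) (\<lambda>(x, y). G {x, y})"

lemma block_density_swap: "block_density V p G (x, y) = block_density V p G (y, x)"
  unfolding block_density_def by (rule cexp_measurable) auto

lemma block_density_range: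
  assumes "\<And>e. 0 \<le> G e" "\<And>e. G e \<le> 1"
  shows "0 \<le> block_density V p G w" "block_density V p G w \<le> 1"
  unfolding block_density_def using assms by (auto intro!: cexp_nonneg cexp_le_1)

text \<open>One half of the cut norm: only an excess of the averaged density over the graph is
  bounded. This is the direction that bounds cliques of the template by cliques of the
  graph.\<close>

definition cut_regular :: "'a set \<Rightarrow> real \<Rightarrow> ('a \<Rightarrow> nat) \<Rightarrow> ('a set \<Rightarrow> real) \<Rightarrow> bool" where
  "cut_regular V \<epsilon> p G \<longleftrightarrow> (\<forall>S T. S \<subseteq> V \<longrightarrow> T \<subseteq> V \<longrightarrow>
     (\<Sum>x\<in>S. \<Sum>y\<in>T. block_density V p G (x, y) - G {x, y}) \<le> \<epsilon> * real (card V) ^ 2)"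

lemma energy_mono:
  assumes "finite \<Omega>"
    and "\<And>v w. v \<in> \<Omega> \<Longrightarrow> w \<in> \<Omega> \<Longrightarrow> \<pi>' v = \<pi>' w \<Longrightarrow> \<pi> v = \<pi> w"
  shows "(\<Sum>w\<in>\<Omega>. (cexp \<Omega> \<pi> f w)\<^sup>2) \<le> (\<Sum>w\<in>\<Omega>. (cexp \<Omega> \<pi>' f w)\<^sup>2)"
proof -
  have "0 \<le> (\<Sum>w\<in>\<Omega>. (cexp \<Omega> \<pi>' f w - cexp \<Omega> \<pi> f w)\<^sup>2)" by (rule sum_nonneg) simp
  then show ?thesis by (simp flip: energy_refine[OF assms])
qed

text \<open>Splitting every part by membership in the two witness sets makes the witness constant on
  blocks, at the price of four times as many parts.\<close>

lemma refine_irregular_partition: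
  assumes V: "finite V" and p: "p \<in> V \<rightarrow>\<^sub>E {..<N}" and "\<epsilon> > 0" and irreg: "\<not> cut_regular V \<epsilon> p G"
  obtains p' where "p' \<in> V \<rightarrow>\<^sub>E {..<4 * N}"
    and "\<And>v w. v \<in> V \<Longrightarrow> w \<in> V \<Longrightarrow> p' v = p' w \<Longrightarrow> p v = p w"
    and "(\<Sum>w\<in>V \<times> V. (block_density V p G w)\<^sup>2) + \<epsilon>\<^sup>2 * real (card V) ^ 2
       \<le> (\<Sum>w\<in>V \<times> V. (block_density V p' G w)\<^sup>2)"
proof -
  obtain S T where ST: "S \<subseteq> V" "T \<subseteq> V"
    and big: "\<epsilon> * real (card V) ^ 2 < (\<Sum>x\<in>S. \<Sum>y\<in>T. block_density V p G (x, y) - G {x, y})"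
    using irreg by (auto simp: cut_regular_def not_le)
  have "S \<noteq> {}" using big \<open>\<epsilon> > 0\<close> by (auto simp: mult_less_0_iff)
  then have n: "card V > 0" using ST V by (auto simp: card_gt_0_iff)
  \<comment> \<open>Base-four code: the old part followed by the two membership bits.\<close>
  define p' where "p' = (\<lambda>v\<in>V. 4 * p v + 2 * of_bool (v \<in> S) + of_bool (v \<in> T))"
  have "4 * p v + 2 * of_bool (v \<in> S) + of_bool (v \<in> T) < 4 * N" if "v \<in> V" for v
  proof -
    have "p v < N" using p that by auto
    then show ?thesis by (auto simp: of_bool_def)
  qed
  then have 1: "p' \<in> V \<rightarrow>\<^sub>E {..<4 * N}" by (auto simp: p'_def)
  have p'_eq: "p v = p w \<and> (v \<in> S \<longleftrightarrow> w \<in> S) \<and> (v \<in> T \<longleftrightarrow> w \<in> T)"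
    if "v \<in> V" "w \<in> V" "p' v = p' w" for v w
  proof -
    have eq: "4 * p v + 2 * of_bool (v \<in> S) + of_bool (v \<in> T) = 4 * p w + 2 * of_bool (w \<in> S) + of_bool (w \<in> T)"
      using that by (simp add: p'_def)
    show ?thesis
      by (cases "v \<in> S"; cases "w \<in> S"; cases "v \<in> T"; cases "w \<in> T") (use eq in \<open>simp; presburger\<close>)+
  qed
  then have 2: "\<And>v w. v \<in> V \<Longrightarrow> w \<in> V \<Longrightarrow> p' v = p' w \<Longrightarrow> p v = p w" by blast
  define c where "c = (\<lambda>w. block_density V p G w - (\<lambda>(x, y). G {x, y}) w)"
  \<comment> \<open>The indicator of S \<times> T is not a function of an unordered label. Its
    symmetrisation is, and it has the same correlation with the symmetric error
    \<open>c\<close>.\<close>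
  define h where "h = (\<lambda>(x, y). (of_bool (x \<in> S \<and> y \<in> T) + of_bool (y \<in> S \<and> x \<in> T)) / 2 :: real)"
  have ST_sum: "(\<Sum>w\<in>V \<times> V. c w * of_bool (fst w \<in> S \<and> snd w \<in> T)) = (\<Sum>x\<in>S. \<Sum>y\<in>T. c (x, y))"
  proof -
    have "V \<times> V \<inter> {w. fst w \<in> S \<and> snd w \<in> T} = S \<times> T" using ST by auto
    then show ?thesis using V by (simp add: sum.cartesian_product)
  qed
  have "(\<Sum>w\<in>V \<times> V. c w * of_bool (snd w \<in> S \<and> fst w \<in> T)) = (\<Sum>w\<in>V \<times> V. c w * of_bool (fst w \<in> S \<and> snd w \<in> T))"
    by (rule sum.reindex_bij_witness[of _ prod.swap prod.swap])
       (auto simp: c_def insert_commute block_density_swap)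
  then have sum_h: "(\<Sum>w\<in>V \<times> V. c w * h w) = (\<Sum>x\<in>S. \<Sum>y\<in>T. c (x, y))"
    using ST_sum by (simp add: h_def case_prod_unfold algebra_simps sum.distrib add_divide_distrib
        flip: sum_divide_distrib)
  have "(\<epsilon> * real (card V) ^ 2)\<^sup>2 \<le> real (card (V \<times> V)) *
      ((\<Sum>w\<in>V \<times> V. (block_density V p' G w)\<^sup>2) - (\<Sum>w\<in>V \<times> V. (block_density V p G w)\<^sup>2))"
    unfolding block_density_def
  proof (rule energy_increment)
    show "\<epsilon> * real (card V) ^ 2 < (\<Sum>w\<in>V \<times> V. (cexp (V \<times> V) (\<lambda>(x, y). {p x, p y}) (\<lambda>(x, y). G {x, y}) w
        - (\<lambda>(x, y). G {x, y}) w) * h w)"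
      using big sum_h by (simp add: c_def block_density_def)
    fix v w assume vw: "v \<in> V \<times> V" "w \<in> V \<times> V" "(\<lambda>(x, y). {p' x, p' y}) v = (\<lambda>(x, y). {p' x, p' y}) w"
    obtain x y x' y' where xy: "v = (x, y)" "w = (x', y')" by (cases v, cases w) auto
    with vw have mem: "x \<in> V" "y \<in> V" "x' \<in> V" "y' \<in> V" by auto
    from vw(3) have "p' x = p' x' \<and> p' y = p' y' \<or> p' x = p' y' \<and> p' y = p' x'"
      by (simp add: xy doubleton_eq_iff)
    then have "(\<lambda>(x, y). {p x, p y}) v = (\<lambda>(x, y). {p x, p y}) w \<and> h v = h w"
    proof
      assume "p' x = p' x' \<and> p' y = p' y'"
      with p'_eq[of x x'] p'_eq[of y y'] mem show ?thesis by (simp add: xy h_def)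
    next
      assume "p' x = p' y' \<and> p' y = p' x'"
      with p'_eq[of x y'] p'_eq[of y x'] mem show ?thesis
        by (simp add: xy h_def insert_commute add.commute conj_commute)
    qed
    then show "(\<lambda>(x, y). {p x, p y}) v = (\<lambda>(x, y). {p x, p y}) w" and "h v = h w" by auto
  qed (use V \<open>\<epsilon> > 0\<close> in \<open>auto simp: h_def of_bool_def\<close>)
  then have "(\<epsilon>\<^sup>2 * real (card V) ^ 2) * real (card V) ^ 2 \<le>
      ((\<Sum>w\<in>V \<times> V. (block_density V p' G w)\<^sup>2) - (\<Sum>w\<in>V \<times> V. (block_density V p G w)\<^sup>2)) * real (card V) ^ 2"
    by (simp add: power2_eq_square card_cartesian_product algebra_simps)
  then have "(\<Sum>w\<in>V \<times> V. (block_density V p G w)\<^sup>2) + \<epsilon>\<^sup>2 * real (card V) ^ 2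
       \<le> (\<Sum>w\<in>V \<times> V. (block_density V p' G w)\<^sup>2)"
    using n by simp
  then show ?thesis using that 1 2 by blast
qed

text \<open>The potential is the sum of the energies over C. Refining for one irregular member gains
  \<epsilon>^2 n^2 there and loses nothing elsewhere, while the total is at most card C * n^2. So
  the gain cannot occur M times, and one partition serves all of C.\<close>

lemma weak_regularity:
  fixes G :: "'c \<Rightarrow> 'a set \<Rightarrow> real"
  assumes V: "finite V" "V \<noteq> {}" and C: "finite C" and "\<epsilon> > 0"
    and G: "\<And>c e. 0 \<le> G c e" "\<And>c e. G c e \<le> 1"
    and M: "real (card C) < real M * \<epsilon>\<^sup>2"
  obtains p where "p \<in> V \<rightarrow>\<^sub>E {..<4 ^ M}" "\<And>c. c \<in> C \<Longrightarrow> cut_regular V \<epsilon> p (G c)"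
proof -
  let ?n2 = "real (card V) ^ 2"
  let ?e = "\<lambda>p c. \<Sum>w\<in>V \<times> V. (block_density V p (G c) w)\<^sup>2"
  \<comment> \<open>A partition that is already regular is simply kept, hence the
    disjunction.\<close>
  have "\<exists>p \<in> V \<rightarrow>\<^sub>E {..<4 ^ i}. (\<forall>c\<in>C. cut_regular V \<epsilon> p (G c)) \<or> real i * \<epsilon>\<^sup>2 * ?n2 \<le> sum (?e p) C" for i :: nat
  proof (induction i)
    case 0
    show ?case by (intro bexI[of _ "\<lambda>v\<in>V. 0"]) (auto intro!: sum_nonneg)
  next
    case (Suc i)
    then obtain p where p: "p \<in> V \<rightarrow>\<^sub>E {..<4 ^ i}"
      and or: "(\<forall>c\<in>C. cut_regular V \<epsilon> p (G c)) \<or> real i * \<epsilon>\<^sup>2 * ?n2 \<le> sum (?e p) C" by blast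
    show ?case
    proof (cases "\<forall>c\<in>C. cut_regular V \<epsilon> p (G c)")
      case True
      have "p \<in> V \<rightarrow>\<^sub>E {..<4 ^ Suc i}" by (rule subsetD[OF PiE_mono p]) auto
      then show ?thesis using True by blast
    next
      case False
      then obtain c where c: "c \<in> C" "\<not> cut_regular V \<epsilon> p (G c)" by blast
      obtain p' where p': "p' \<in> V \<rightarrow>\<^sub>E {..<4 * 4 ^ i}"
        and ref: "\<And>v w. v \<in> V \<Longrightarrow> w \<in> V \<Longrightarrow> p' v = p' w \<Longrightarrow> p v = p w"
        and inc: "?e p c + \<epsilon>\<^sup>2 * ?n2 \<le> ?e p' c"
        using refine_irregular_partition[OF V(1) p \<open>\<epsilon> > 0\<close> c(2)] by metis
      have mono: "?e p d \<le> ?e p' d" for d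
        unfolding block_density_def
      proof (rule energy_mono)
        fix v w assume "v \<in> V \<times> V" "w \<in> V \<times> V" "(\<lambda>(x, y). {p' x, p' y}) v = (\<lambda>(x, y). {p' x, p' y}) w"
        then show "(\<lambda>(x, y). {p x, p y}) v = (\<lambda>(x, y). {p x, p y}) w"
          by (auto simp: doubleton_eq_iff dest: ref)
      qed (use V in auto)
      have "sum (?e p) C + \<epsilon>\<^sup>2 * ?n2 = (?e p c + \<epsilon>\<^sup>2 * ?n2) + sum (?e p) (C - {c})"
        using c C by (simp add: sum.remove)
      also have "\<dots> \<le> ?e p' c + sum (?e p') (C - {c})"
        by (intro add_mono inc sum_mono mono)
      also have "\<dots> = sum (?e p') C"
        using c C by (simp add: sum.remove)
      finally have "real (Suc i) * \<epsilon>\<^sup>2 * ?n2 \<le> sum (?e p') C"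
        using or False by (auto simp: algebra_simps)
      then show ?thesis using p' by auto
    qed
  qed
  from this[of M] obtain p where p: "p \<in> V \<rightarrow>\<^sub>E {..<4 ^ M}"
      and or: "(\<forall>c\<in>C. cut_regular V \<epsilon> p (G c)) \<or> real M * \<epsilon>\<^sup>2 * ?n2 \<le> sum (?e p) C" by blast
  have "?e p c \<le> ?n2" for c
  proof -
    have "?e p c \<le> (\<Sum>w\<in>V \<times> V. 1)"
      by (intro sum_mono power_le_one block_density_range G)
    then show ?thesis by (simp add: card_cartesian_product power2_eq_square)
  qed
  then have "sum (?e p) C \<le> real (card C) * ?n2" by (intro sum_bounded_above)
  also have "\<dots> < real M * \<epsilon>\<^sup>2 * ?n2" using M V by (auto simp: card_gt_0_iff)
  finally show ?thesis using or p that by auto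
qed

section \<open>Cut norm: from sets to weights\<close>

text \<open>A linear form on a cube is maximal at a vertex: keep exactly the points where g is
  positive.\<close>

lemma sum_weighted_le_sum_subset:
  fixes g a :: "'a \<Rightarrow> real"
  assumes "finite V" "\<And>x. x \<in> V \<Longrightarrow> 0 \<le> a x \<and> a x \<le> 1"
  obtains S where "S \<subseteq> V" "(\<Sum>x\<in>V. a x * g x) \<le> sum g S"
proof -
  have "(\<Sum>x\<in>V. a x * g x) \<le> (\<Sum>x\<in>V. if g x > 0 then g x else 0)"
    using assms by (intro sum_mono) (auto simp: mult_le_cancel_right1 mult_nonneg_nonpos)
  also have "\<dots> = sum g {x\<in>V. g x > 0}"
    using assms by (simp add: sum.inter_filter)
  finally show ?thesis using that[of "{x\<in>V. g x > 0}"] by auto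
qed

text \<open>The form is linear in each weight separately: round a to a set first, then b.\<close>

lemma bilinear_form_le:
  fixes D :: "'a \<Rightarrow> 'a \<Rightarrow> real"
  assumes V: "finite V"
    and D: "\<And>S T. S \<subseteq> V \<Longrightarrow> T \<subseteq> V \<Longrightarrow> (\<Sum>x\<in>S. \<Sum>y\<in>T. D x y) \<le> \<eta>"
    and a: "\<And>x. x \<in> V \<Longrightarrow> 0 \<le> a x \<and> a x \<le> 1" and b: "\<And>x. x \<in> V \<Longrightarrow> 0 \<le> b x \<and> b x \<le> 1"
  shows "(\<Sum>x\<in>V. \<Sum>y\<in>V. D x y * (a x * b y)) \<le> \<eta>"
proof -
  obtain S where S: "S \<subseteq> V" "(\<Sum>x\<in>V. a x * (\<Sum>y\<in>V. D x y * b y)) \<le> (\<Sum>x\<in>S. \<Sum>y\<in>V. D x y * b y)"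
    by (rule sum_weighted_le_sum_subset[OF V, of a "\<lambda>x. \<Sum>y\<in>V. D x y * b y"]) (use a in auto)
  obtain T where T: "T \<subseteq> V" "(\<Sum>y\<in>V. b y * (\<Sum>x\<in>S. D x y)) \<le> (\<Sum>y\<in>T. \<Sum>x\<in>S. D x y)"
    by (rule sum_weighted_le_sum_subset[OF V, of b "\<lambda>y. \<Sum>x\<in>S. D x y"]) (use b in auto)
  have "(\<Sum>x\<in>V. \<Sum>y\<in>V. D x y * (a x * b y)) = (\<Sum>x\<in>V. a x * (\<Sum>y\<in>V. D x y * b y))"
    by (simp add: sum_distrib_left mult_ac)
  also have "\<dots> \<le> (\<Sum>x\<in>S. \<Sum>y\<in>V. D x y * b y)" by (rule S)
  also have "\<dots> = (\<Sum>y\<in>V. b y * (\<Sum>x\<in>S. D x y))"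
    by (subst sum.swap) (simp add: sum_distrib_left mult_ac)
  also have "\<dots> \<le> (\<Sum>y\<in>T. \<Sum>x\<in>S. D x y)" by (rule T)
  also have "\<dots> = (\<Sum>x\<in>S. \<Sum>y\<in>T. D x y)" by (rule sum.swap)
  also have "\<dots> \<le> \<eta>" using D S T by blast
  finally show ?thesis .
qed

section \<open>Counting cliques\<close>

abbreviation uexp :: "'a set \<Rightarrow> 'b set \<Rightarrow> (('a \<Rightarrow> 'b) \<Rightarrow> real) \<Rightarrow> real" where
  "uexp I V \<equiv> pexp I V (\<lambda>_. 1 / real (card V))"

text \<open>With all coordinates but i and j frozen, U is a weight in \<open>x i\<close> alone and W
  one in \<open>x j\<close> alone, so the inner average is a bilinear form in D.\<close>

lemma uexp_bilinear_le:
  assumes I: "finite I" "i \<in> I" "j \<in> I" "i \<noteq> j" and V: "finite V" "V \<noteq> {}"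
    and D: "\<And>S T. S \<subseteq> V \<Longrightarrow> T \<subseteq> V \<Longrightarrow> (\<Sum>x\<in>S. \<Sum>y\<in>T. D x y) \<le> \<epsilon> * real (card V) ^ 2"
    and U: "\<And>x. x \<in> I \<rightarrow>\<^sub>E V \<Longrightarrow> 0 \<le> U x \<and> U x \<le> 1" "\<And>x p. U (x(j := p)) = U x"
    and W: "\<And>x. x \<in> I \<rightarrow>\<^sub>E V \<Longrightarrow> 0 \<le> W x \<and> W x \<le> 1" "\<And>x p. W (x(i := p)) = W x"
  shows "uexp I V (\<lambda>x. D (x i) (x j) * (U x * W x)) \<le> \<epsilon>"
proof -
  define n where "n = real (card V)"
  have n: "n > 0" using V by (auto simp: n_def card_gt_0_iff)
  have one: "(\<Sum>_\<in>V. 1 / real (card V)) = 1" using V by simp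
  let ?F = "\<lambda>x. D (x i) (x j) * (U x * W x)"
  \<comment> \<open>Redraw i and j; the bound then holds pointwise in the remaining
    coordinates.\<close>
  have "uexp I V ?F = uexp I V (\<lambda>x. \<Sum>p\<in>V. 1 / n * ?F (x(i := p)))"
    unfolding n_def by (rule pexp_resample[OF I(1,2) one])
  also have "\<dots> = uexp I V (\<lambda>x. \<Sum>q\<in>V. 1 / n * (\<Sum>p\<in>V. 1 / n * ?F (x(j := q, i := p))))"
    unfolding n_def by (rule pexp_resample[OF I(1,3) one])
  also have "\<dots> \<le> uexp I V (\<lambda>x. \<epsilon>)"
  proof (rule pexp_mono)
    fix x assume x: "x \<in> I \<rightarrow>\<^sub>E V"
    have upd: "x(k := p) \<in> I \<rightarrow>\<^sub>E V" if "k \<in> I" "p \<in> V" for k p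
      using x that by (auto simp: PiE_iff extensional_def)
    have F: "?F (x(j := q, i := p)) = D p q * (U (x(i := p)) * W (x(j := q)))" for p q
    proof -
      have "U (x(j := q, i := p)) = U (x(i := p))"
        using U(2) \<open>i \<noteq> j\<close> by (metis fun_upd_twist)
      then show ?thesis using W(2) \<open>i \<noteq> j\<close> by simp
    qed
    have "(\<Sum>q\<in>V. 1 / n * (\<Sum>p\<in>V. 1 / n * ?F (x(j := q, i := p))))
        = (\<Sum>q\<in>V. \<Sum>p\<in>V. D p q * (U (x(i := p)) * W (x(j := q))) / n ^ 2)"
      unfolding F by (simp add: sum_distrib_left power2_eq_square)
    also have "\<dots> = (\<Sum>p\<in>V. \<Sum>q\<in>V. D p q * (U (x(i := p)) * W (x(j := q))) / n ^ 2)"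
      by (rule sum.swap)
    also have "\<dots> = (\<Sum>p\<in>V. \<Sum>q\<in>V. D p q * (U (x(i := p)) * W (x(j := q)))) / n ^ 2"
      by (simp add: sum_divide_distrib)
    also have "\<dots> \<le> \<epsilon> * n ^ 2 / n ^ 2"
      using D U(1)[OF upd] W(1)[OF upd] I V
      by (intro divide_right_mono bilinear_form_le) (auto simp: n_def)
    finally show "(\<Sum>q\<in>V. 1 / n * (\<Sum>p\<in>V. 1 / n * ?F (x(j := q, i := p)))) \<le> \<epsilon>"
      using n by simp
  qed simp
  also have "\<dots> = \<epsilon>" using I V one by (intro pexp_const) auto
  finally show ?thesis .
qed

text \<open>Telescoping: pairs move one at a time from A, where g is used, to B, where f is used,
  and each move costs at most \<epsilon>.\<close>

lemma counting_lemma: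
  fixes f g :: "'v \<Rightarrow> 'v \<Rightarrow> real" and A B :: "(nat \<times> nat) set"
  assumes I: "finite I" and V: "finite V" "V \<noteq> {}"
    and f: "\<And>x y. 0 \<le> f x y \<and> f x y \<le> 1" and g: "\<And>x y. 0 \<le> g x y \<and> g x y \<le> 1"
    and D: "\<And>S T. S \<subseteq> V \<Longrightarrow> T \<subseteq> V \<Longrightarrow> (\<Sum>x\<in>S. \<Sum>y\<in>T. g x y - f x y) \<le> \<epsilon> * real (card V) ^ 2"
    and "finite A" "finite B" "A \<inter> B = {}" "A \<union> B \<subseteq> {(i, j). i \<in> I \<and> j \<in> I \<and> i < j}"
  shows "uexp I V (\<lambda>x. (\<Prod>(i, j)\<in>A. g (x i) (x j)) * (\<Prod>(i, j)\<in>B. f (x i) (x j)))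
    \<le> uexp I V (\<lambda>x. \<Prod>(i, j)\<in>A \<union> B. f (x i) (x j)) + real (card A) * \<epsilon>"
  using \<open>finite A\<close> \<open>finite B\<close> \<open>A \<inter> B = {}\<close> \<open>A \<union> B \<subseteq> _\<close>
proof (induction A arbitrary: B)
  case empty
  then show ?case by simp
next
  case (insert e A)
  obtain i j where e: "e = (i, j)" by (cases e)
  have ij: "i \<in> I" "j \<in> I" "i < j" "(i, j) \<notin> A" "(i, j) \<notin> B" using insert.prems insert.hyps e by auto
  define w where "w = (\<lambda>a. if a \<in> A then g else f)"
  \<comment> \<open>Pairs avoiding j give a factor independent of \<open>x j\<close>. The others
    contain j, and none of them contains i: (i, j) is the pair being exchanged, and (j, i) is not
    increasing.\<close>
  define E1 E2 where "E1 = {a \<in> A \<union> B. fst a \<noteq> j \<and> snd a \<noteq> j}" and "E2 = {a \<in> A \<union> B. \<not> (fst a \<noteq> j \<and> snd a \<noteq> j)}"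
  define P where "P = (\<lambda>E x. \<Prod>a\<in>E. w a (x (fst a)) (x (snd a)))"
  have fin: "finite E1" "finite E2" using insert.prems insert.hyps by (auto simp: E1_def E2_def)
  have split: "(\<Prod>(i, j)\<in>A. g (x i) (x j)) * (\<Prod>(i, j)\<in>B. f (x i) (x j)) = P E1 x * P E2 x" for x
  proof -
    have "P E1 x * P E2 x = P (A \<union> B) x"
    proof -
      have "A \<union> B = E1 \<union> E2" "E1 \<inter> E2 = {}" by (auto simp: E1_def E2_def)
      then show ?thesis using fin by (simp add: P_def prod.union_disjoint)
    qed
    also have "\<dots> = P A x * P B x"
      unfolding P_def using insert.prems insert.hyps by (subst prod.union_disjoint) auto
    also have "P A x = (\<Prod>(i, j)\<in>A. g (x i) (x j))"
      unfolding P_def by (intro prod.cong) (auto simp: w_def)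
    also have "P B x = (\<Prod>(i, j)\<in>B. f (x i) (x j))"
      unfolding P_def using insert.prems by (intro prod.cong) (auto simp: w_def)
    finally show ?thesis by simp
  qed
  have P01: "0 \<le> P E x \<and> P E x \<le> 1" for E x
    unfolding P_def using f g by (auto simp: w_def intro!: prod_nonneg prod_le_1)
  have "uexp I V (\<lambda>x. (g (x i) (x j) - f (x i) (x j)) * (P E1 x * P E2 x)) \<le> \<epsilon>"
  proof (rule uexp_bilinear_le[where D = "\<lambda>a b. g a b - f a b"])
    show "P E1 (x(j := p)) = P E1 x" for x p
      unfolding P_def by (intro prod.cong) (auto simp: E1_def)
    have "fst a \<noteq> i \<and> snd a \<noteq> i" if "a \<in> E2" for a
    proof -
      have "a \<noteq> (i, j)" "fst a < snd a" "fst a = j \<or> snd a = j"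
        using that ij insert.prems by (auto simp: E2_def)
      then show ?thesis using ij by (cases a) auto
    qed
    then show "P E2 (x(i := p)) = P E2 x" for x p
      unfolding P_def by (intro prod.cong) auto
  qed (use I V ij D P01 in auto)
  moreover have "uexp I V (\<lambda>x. (\<Prod>(i, j)\<in>insert e A. g (x i) (x j)) * (\<Prod>(i, j)\<in>B. f (x i) (x j)))
      = uexp I V (\<lambda>x. (g (x i) (x j) - f (x i) (x j)) * (P E1 x * P E2 x)
          + (\<Prod>(i, j)\<in>A. g (x i) (x j)) * (\<Prod>(i, j)\<in>insert e B. f (x i) (x j)))"
    unfolding split[symmetric] using insert.prems insert.hyps ij
    by (intro pexp_cong) (simp add: e algebra_simps)
  moreover have "uexp I V (\<lambda>x. (\<Prod>(i, j)\<in>A. g (x i) (x j)) * (\<Prod>(i, j)\<in>insert e B. f (x i) (x j)))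
      \<le> uexp I V (\<lambda>x. \<Prod>(i, j)\<in>A \<union> insert e B. f (x i) (x j)) + real (card A) * \<epsilon>"
    using insert.prems insert.hyps by (intro insert.IH) auto
  moreover have "insert e A \<union> B = A \<union> insert e B" by auto
  moreover have "real (card (insert e A)) * \<epsilon> = \<epsilon> + real (card A) * \<epsilon>"
    using insert.hyps by (simp add: algebra_simps)
  ultimately show ?case by (simp only: pexp_add)
qed

lemma mult_of_bool_le:
  fixes d G :: real
  assumes "b \<Longrightarrow> d \<le> G" "0 \<le> G"
  shows "d * of_bool b \<le> G"
  using assms by (cases b) auto

text \<open>Markov's inequality: where all pairs are dense the product of g is at least \<delta> ^
  card A, while the product of f vanishes identically. The hypothesis \<open>free\<close> covers
  non-injective tuples as well.\<close>

lemma few_dense_cliques: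
  fixes f g :: "'v \<Rightarrow> 'v \<Rightarrow> real" and A :: "(nat \<times> nat) set"
  assumes I: "finite I" and V: "finite V" "V \<noteq> {}"
    and f: "\<And>x y. 0 \<le> f x y \<and> f x y \<le> 1" and g: "\<And>x y. 0 \<le> g x y \<and> g x y \<le> 1"
    and D: "\<And>S T. S \<subseteq> V \<Longrightarrow> T \<subseteq> V \<Longrightarrow> (\<Sum>x\<in>S. \<Sum>y\<in>T. g x y - f x y) \<le> \<epsilon> * real (card V) ^ 2"
    and A: "finite A" "A \<subseteq> {(i, j). i \<in> I \<and> j \<in> I \<and> i < j}"
    and free: "\<And>x. x \<in> I \<rightarrow>\<^sub>E V \<Longrightarrow> \<exists>(i, j)\<in>A. f (x i) (x j) = 0"
    and "0 < \<delta>"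
  shows "uexp I V (\<lambda>x. of_bool (\<forall>(i, j)\<in>A. \<delta> < g (x i) (x j))) \<le> real (card A) * \<epsilon> / \<delta> ^ card A"
proof -
  have one: "(\<Sum>_\<in>V. 1 / real (card V)) = 1" using V by simp
  have "\<delta> ^ card A * uexp I V (\<lambda>x. of_bool (\<forall>(i, j)\<in>A. \<delta> < g (x i) (x j)))
      = uexp I V (\<lambda>x. \<delta> ^ card A * of_bool (\<forall>(i, j)\<in>A. \<delta> < g (x i) (x j)))"
    by (simp add: pexp_cmult)
  also have "\<dots> \<le> uexp I V (\<lambda>x. \<Prod>(i, j)\<in>A. g (x i) (x j))"
  proof (rule pexp_mono)
    fix x
    have 1: "(\<Prod>a\<in>A. \<delta>) \<le> (\<Prod>(i, j)\<in>A. g (x i) (x j))" if "\<forall>(i, j)\<in>A. \<delta> < g (x i) (x j)"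
      using that \<open>0 < \<delta>\<close> by (intro prod_mono) force
    have 2: "0 \<le> (\<Prod>(i, j)\<in>A. g (x i) (x j))" using g by (intro prod_nonneg) auto
    show "\<delta> ^ card A * of_bool (\<forall>(i, j)\<in>A. \<delta> < g (x i) (x j)) \<le> (\<Prod>(i, j)\<in>A. g (x i) (x j))"
      by (rule mult_of_bool_le) (use 1 2 in simp_all)
  qed simp
  also have "\<dots> \<le> uexp I V (\<lambda>x. \<Prod>(i, j)\<in>A. f (x i) (x j)) + real (card A) * \<epsilon>"
    using counting_lemma[OF I V f g D, of A "{}"] A by simp
  also have "uexp I V (\<lambda>x. \<Prod>(i, j)\<in>A. f (x i) (x j)) = uexp I V (\<lambda>x. 0)"
  proof (rule pexp_cong)
    fix x assume "x \<in> I \<rightarrow>\<^sub>E V"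
    from free[OF this] obtain i j where "(i, j) \<in> A" "f (x i) (x j) = 0" by auto
    then show "(\<Prod>(i, j)\<in>A. f (x i) (x j)) = 0"
      using A(1) by (intro prod_zero bexI[of _ "(i, j)"]) auto
  qed
  also have "\<dots> = 0" by (simp add: pexp_def)
  finally show ?thesis using \<open>0 < \<delta>\<close> by (simp add: field_simps)
qed

section \<open>Ramsey numbers and Lagrangians\<close>

text \<open>Asking for a pair that misses the colour, instead of naming an edge set, lets the
  property pass along injections and to smaller colour sets. Valid colourings, members of
  \<open>Phi\<close> and sampled templates are all tested by it.\<close>

definition clique_free_map :: "nat \<Rightarrow> (nat \<Rightarrow> nat) \<Rightarrow> 'a set \<Rightarrow> ('a set \<Rightarrow> nat set) \<Rightarrow> bool" where
  "clique_free_map s k V \<phi> \<longleftrightarrow> (\<forall>c\<in>{1..s}. \<forall>H\<in>[V]\<^bsup>k c\<^esup>. \<exists>e\<in>[H]\<^bsup>2\<^esup>. c \<notin> \<phi> e)"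

lemma clique_free_map_iff:
  "clique_free_map s k V \<phi> \<longleftrightarrow> (\<forall>c\<in>{1..s}. \<not> contains_clique V {e \<in> [V]\<^bsup>2\<^esup>. c \<in> \<phi> e} (k c))"
proof -
  have "[H]\<^bsup>2\<^esup> \<subseteq> [V]\<^bsup>2\<^esup>" if "H \<in> [V]\<^bsup>m\<^esup>" for H m
    using that by (intro nsets_mono) (auto simp: nsets_def)
  then show ?thesis unfolding clique_free_map_def contains_clique_def by blast
qed

lemma clique_free_map_mono:
  assumes "clique_free_map s k V \<phi>" "\<And>e. e \<in> [V]\<^bsup>2\<^esup> \<Longrightarrow> \<psi> e \<subseteq> \<phi> e"
  shows "clique_free_map s k V \<psi>"
  using assms unfolding clique_free_map_iff contains_clique_def by blast

lemma clique_free_map_pullback: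
  assumes "clique_free_map s k V \<phi>" "inj_on b W" "b ` W \<subseteq> V"
  shows "clique_free_map s k W (\<lambda>e. \<phi> (b ` e))"
  unfolding clique_free_map_def
proof (intro ballI)
  fix c H assume c: "c \<in> {1..s}" and H: "H \<in> [W]\<^bsup>k c\<^esup>"
  have inj: "inj_on b H" using H assms(2) by (auto simp: nsets_def intro: inj_on_subset)
  then have "b ` H \<in> [V]\<^bsup>k c\<^esup>" using H assms(3) by (auto simp: nsets_def card_image)
  then obtain e where e: "e \<in> [b ` H]\<^bsup>2\<^esup>" "c \<notin> \<phi> e"
    using assms(1) c unfolding clique_free_map_def by blast
  then obtain x y where "e = {b x, b y}" "x \<in> H" "y \<in> H" "b x \<noteq> b y" by (auto elim!: nsets2_E)
  then show "\<exists>e\<in>[H]\<^bsup>2\<^esup>. c \<notin> \<phi> (b ` e)"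
    using e by (intro bexI[of _ "{x, y}"]) auto
qed

lemma valid_colourings_iff:
  assumes "E \<subseteq> [V]\<^bsup>2\<^esup>"
  shows "\<sigma> \<in> valid_colourings s k V E \<longleftrightarrow>
    \<sigma> \<in> E \<rightarrow>\<^sub>E {1..s} \<and> clique_free_map s k V (\<lambda>e. {c. e \<in> E \<and> \<sigma> e = c})"
proof -
  have "{e \<in> [V]\<^bsup>2\<^esup>. c \<in> {c. e \<in> E \<and> \<sigma> e = c}} = {e \<in> E. \<sigma> e = c}" for c
    using assms by auto
  then show ?thesis by (simp add: valid_colourings_def clique_free_map_iff)
qed

lemma valid_colouring_of_clique_free_map:
  assumes "clique_free_map s k V \<phi>" "\<And>e. e \<in> [V]\<^bsup>2\<^esup> \<Longrightarrow> \<phi> e \<inter> {1..s} \<noteq> {}"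
  shows "valid_colourings s k V ([V]\<^bsup>2\<^esup>) \<noteq> {}"
proof -
  define \<sigma> where "\<sigma> = (\<lambda>e\<in>[V]\<^bsup>2\<^esup>. SOME c. c \<in> \<phi> e \<inter> {1..s})"
  have \<sigma>: "\<sigma> e \<in> \<phi> e \<inter> {1..s}" if "e \<in> [V]\<^bsup>2\<^esup>" for e
    using assms(2)[OF that] that some_in_eq[of "\<phi> e \<inter> {1..s}"] by (simp add: \<sigma>_def)
  have "clique_free_map s k V (\<lambda>e. {c. e \<in> [V]\<^bsup>2\<^esup> \<and> \<sigma> e = c})"
    by (rule clique_free_map_mono[OF assms(1)]) (use \<sigma> in auto)
  moreover have "\<sigma> \<in> [V]\<^bsup>2\<^esup> \<rightarrow>\<^sub>E {1..s}"
    using \<sigma> by (fastforce simp: \<sigma>_def PiE_iff)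
  ultimately have "\<sigma> \<in> valid_colourings s k V ([V]\<^bsup>2\<^esup>)"
    by (simp add: valid_colourings_iff)
  then show ?thesis by blast
qed

text \<open>Ramsey's theorem for several colours; it gives the \<open>LEAST\<close> in
  \<open>ramsey_number\<close> a witness.\<close>

lemma no_valid_colouring_exists: "\<exists>N :: nat. valid_colourings s k {1..N} ([{1..N}]\<^bsup>2\<^esup>) = {}"
proof -
  obtain N :: nat where N: "partn_lst {..<N} (map (\<lambda>c. k (Suc c)) [0..<s]) 2"
    using ramsey_full[of "map (\<lambda>c. k (Suc c)) [0..<s]" 2] by blast
  have False if \<sigma>: "\<sigma> \<in> valid_colourings s k {1..N} ([{1..N}]\<^bsup>2\<^esup>)" for \<sigma>
  proof -
    have \<sigma>1: "\<sigma> e \<in> {1..s}" if "e \<in> [{1..N}]\<^bsup>2\<^esup>" for e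
      using \<sigma> that by (auto simp: valid_colourings_def)
    have cf: "clique_free_map s k {1..N} (\<lambda>e. {c. e \<in> [{1..N}]\<^bsup>2\<^esup> \<and> \<sigma> e = c})"
      using \<sigma> by (simp add: valid_colourings_iff)
    \<comment> \<open>\<open>partn_lst\<close> numbers colours from 0 and N is used there as
      \<open>{..<N}\<close>; here both start at 1.\<close>
    define f where "f = (\<lambda>e. \<sigma> (Suc ` e) - 1)"
    have Suc: "Suc ` e \<in> [{1..N}]\<^bsup>2\<^esup>" if "e \<in> [{..<N}]\<^bsup>2\<^esup>" for e
      using that by (auto simp: nsets_def card_image)
    have "f \<in> [{..<N}]\<^bsup>2\<^esup> \<rightarrow> {..<s}"
      using \<sigma>1[OF Suc] by (fastforce simp: f_def)
    then obtain i H where i: "i < s" "H \<in> [{..<N}]\<^bsup>k (Suc i)\<^esup>" "f ` [H]\<^bsup>2\<^esup> \<subseteq> {i}"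
      using N by (force simp: partn_lst_def monochromatic_def)
    have "clique_free_map s k {..<N} (\<lambda>e. {c. Suc ` e \<in> [{1..N}]\<^bsup>2\<^esup> \<and> \<sigma> (Suc ` e) = c})"
      by (rule clique_free_map_pullback[OF cf]) auto
    moreover have "Suc i \<in> {1..s}" using i by auto
    ultimately obtain e where e: "e \<in> [H]\<^bsup>2\<^esup>" "\<not> (Suc ` e \<in> [{1..N}]\<^bsup>2\<^esup> \<and> \<sigma> (Suc ` e) = Suc i)"
      using i unfolding clique_free_map_def by blast
    have "[H]\<^bsup>2\<^esup> \<subseteq> [{..<N}]\<^bsup>2\<^esup>" using i by (intro nsets_mono) (auto simp: nsets_def)
    with e have "Suc ` e \<in> [{1..N}]\<^bsup>2\<^esup>" using Suc by blast
    with \<sigma>1[OF this] e have "\<sigma> (Suc ` e) \<in> {1..s}" "\<sigma> (Suc ` e) \<noteq> Suc i" by auto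
    moreover have "f e = i" using e i by blast
    ultimately show False using e by (auto simp: f_def)
  qed
  then show ?thesis by blast
qed

text \<open>Otherwise as many vertices as the Ramsey number could be selected, and one permitted
  colour per pair would be a valid colouring of the complete graph on them.\<close>

lemma card_less_ramsey_number:
  assumes "finite V" "clique_free_map s k V \<phi>" "\<And>e. e \<in> [V]\<^bsup>2\<^esup> \<Longrightarrow> \<phi> e \<inter> {1..s} \<noteq> {}"
  shows "card V < ramsey_number s k"
proof (rule ccontr)
  let ?R = "ramsey_number s k"
  assume "\<not> card V < ?R"
  then have "card {1..?R} \<le> card V" by simp
  then obtain b where b: "b ` {1..?R} \<subseteq> V" "inj_on b {1..?R}"
    using assms(1) card_le_inj[of "{1..?R}" V] by auto
  have "clique_free_map s k {1..?R} (\<lambda>e. \<phi> (b ` e))"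
    by (rule clique_free_map_pullback[OF assms(2) b(2,1)])
  moreover have "\<phi> (b ` e) \<inter> {1..s} \<noteq> {}" if "e \<in> [{1..?R}]\<^bsup>2\<^esup>" for e
  proof (rule assms(3))
    show "b ` e \<in> [V]\<^bsup>2\<^esup>"
      using that b by (auto simp: nsets_def card_image inj_on_subset)
  qed
  ultimately have "valid_colourings s k {1..?R} ([{1..?R}]\<^bsup>2\<^esup>) \<noteq> {}"
    by (rule valid_colouring_of_clique_free_map)
  then show False
    unfolding ramsey_number_def using LeastI_ex[OF no_valid_colouring_exists, of s k] by blast
qed

section \<open>Lagrangians\<close>

text \<open>Ordered pairs absorb the factor 2 of \<open>q\<close>; an arbitrary index set allows
  vertices to be deleted without renumbering.\<close>

definition lagr :: "'a set \<Rightarrow> ('a set \<Rightarrow> real) \<Rightarrow> ('a \<Rightarrow> real) \<Rightarrow> real" where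
  "lagr I h \<alpha> = (\<Sum>i\<in>I. \<Sum>j\<in>I - {i}. \<alpha> i * \<alpha> j * h {i, j})"

lemma lagr_insert:
  assumes "finite K" "v \<notin> K"
  shows "lagr (insert v K) h \<alpha> = lagr K h \<alpha> + 2 * \<alpha> v * (\<Sum>l\<in>K. \<alpha> l * h {v, l})"
  unfolding lagr_def sum_distinct_pairs_insert[OF assms]
  by (simp add: insert_commute sum_distrib_left algebra_simps)

lemma lagr_cong:
  assumes "\<And>i. i \<in> I \<Longrightarrow> \<alpha> i = \<beta> i"
  shows "lagr I h \<alpha> = lagr I h \<beta>"
  unfolding lagr_def using assms by (intro sum.cong refl) auto

text \<open>If \<open>h {i, j} = 0\<close>, the Lagrangian is linear in moving weight between \<open>i\<close> and \<open>j\<close>, so that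
  all of it can be put on one of the two (Zykov symmetrisation, as in Motzkin-Straus).\<close>

lemma lagr_merge:
  assumes "finite I" and ij: "i \<in> I" "j \<in> I" "i \<noteq> j" "h {i, j} = 0"
    and \<alpha>: "\<And>v. v \<in> I \<Longrightarrow> \<alpha> v \<ge> 0" "sum \<alpha> I = 1"
  obtains J \<beta> where "J \<subset> I" "\<And>v. v \<in> J \<Longrightarrow> \<beta> v \<ge> 0" "sum \<beta> J = 1" "lagr I h \<alpha> \<le> lagr J h \<beta>"
proof -
  define K where "K = I - {i, j}"
  \<comment> \<open>For v = i or v = j, \<open>2 * A v\<close> is the derivative of the Lagrangian
    in the weight of v; the pair \<open>{i, j}\<close> contributes nothing to it.\<close>
  define A where "A = (\<lambda>v. \<Sum>l\<in>K. \<alpha> l * h {v, l})"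
  have main: "\<exists>\<beta>. (\<forall>v\<in>insert i K. \<beta> v \<ge> 0) \<and> sum \<beta> (insert i K) = 1 \<and> lagr I h \<alpha> \<le> lagr (insert i K) h \<beta>"
    if I: "I = insert i (insert j K)" "finite K" "i \<notin> insert j K" "j \<notin> K" "h {i, j} = 0"
      and le: "A j \<le> A i" for i j
  proof -
    define \<beta> where "\<beta> = \<alpha>(i := \<alpha> i + \<alpha> j)"
    have \<beta>K: "\<beta> v = \<alpha> v" if "v \<in> K" for v using that I by (auto simp: \<beta>_def)
    have "lagr I h \<alpha> = lagr K h \<alpha> + 2 * \<alpha> j * A j + 2 * \<alpha> i * A i"
      using I by (simp add: lagr_insert A_def)
    also have "\<dots> \<le> lagr K h \<alpha> + 2 * \<alpha> j * A i + 2 * \<alpha> i * A i"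
      using le \<alpha>(1)[of j] I by (simp add: mult_left_mono)
    also have "\<dots> = lagr K h \<beta> + 2 * \<beta> i * (\<Sum>l\<in>K. \<beta> l * h {i, l})"
      using lagr_cong[of K \<beta> \<alpha> h] by (simp add: \<beta>K A_def algebra_simps) (simp add: \<beta>_def algebra_simps)
    also have "\<dots> = lagr (insert i K) h \<beta>"
      using I by (simp add: lagr_insert)
    finally have "lagr I h \<alpha> \<le> lagr (insert i K) h \<beta>" .
    moreover have "sum \<beta> (insert i K) = 1"
      using I \<alpha>(2) by (simp add: \<beta>K) (simp add: \<beta>_def)
    moreover have "\<forall>v\<in>insert i K. \<beta> v \<ge> 0"
      using \<alpha>(1) I by (auto simp: \<beta>_def)
    ultimately show ?thesis by blast
  qed
  have I: "I = insert i (insert j K)" "I = insert j (insert i K)" "finite K" "i \<notin> K" "j \<notin> K"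
    using assms by (auto simp: K_def)
  have h: "h {j, i} = 0" using ij by (simp add: insert_commute)
  consider "A j \<le> A i" | "A i \<le> A j" by linarith
  then show ?thesis
  proof cases
    case 1
    then obtain \<beta> where "\<forall>v\<in>insert i K. \<beta> v \<ge> 0" "sum \<beta> (insert i K) = 1" "lagr I h \<alpha> \<le> lagr (insert i K) h \<beta>"
      using main[of i j] I ij by blast
    then show ?thesis using I ij by (intro that[of "insert i K" \<beta>]) auto
  next
    case 2
    then obtain \<beta> where "\<forall>v\<in>insert j K. \<beta> v \<ge> 0" "sum \<beta> (insert j K) = 1" "lagr I h \<alpha> \<le> lagr (insert j K) h \<beta>"
      using main[of j i] I ij h by blast
    then show ?thesis using I ij by (intro that[of "insert j K" \<beta>]) auto
  qed
qed

text \<open>Each merge strictly shrinks the index set, so iterating it ends where h has no zero. For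
  h = \<open>lg (\<phi> e)\<close> this means at least two colours on every pair.\<close>

lemma lagr_reduce:
  assumes "finite I" "\<And>v. v \<in> I \<Longrightarrow> \<alpha> v \<ge> 0" "sum \<alpha> I = 1"
  obtains J \<beta> where "J \<subseteq> I" "\<And>v. v \<in> J \<Longrightarrow> \<beta> v \<ge> 0" "sum \<beta> J = 1" "lagr I h \<alpha> \<le> lagr J h \<beta>"
    "\<And>e. e \<in> [J]\<^bsup>2\<^esup> \<Longrightarrow> h e \<noteq> 0"
  using assms
proof (induction I arbitrary: \<alpha> thesis rule: finite_psubset_induct)
  case (psubset I)
  show ?case
  proof (cases "\<exists>e\<in>[I]\<^bsup>2\<^esup>. h e = 0")
    case True
    then obtain i j where ij: "i \<in> I" "j \<in> I" "i \<noteq> j" "h {i, j} = 0" by (auto elim!: nsets2_E)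
    obtain J \<beta> where J: "J \<subset> I" "\<And>v. v \<in> J \<Longrightarrow> \<beta> v \<ge> 0" "sum \<beta> J = 1" "lagr I h \<alpha> \<le> lagr J h \<beta>"
      using lagr_merge[where h = h, OF psubset.hyps ij psubset.prems(2,3)] by metis
    obtain J' \<beta>' where J': "J' \<subseteq> J" "\<And>v. v \<in> J' \<Longrightarrow> \<beta>' v \<ge> 0" "sum \<beta>' J' = 1" "lagr J h \<beta> \<le> lagr J' h \<beta>'"
      "\<And>e. e \<in> [J']\<^bsup>2\<^esup> \<Longrightarrow> h e \<noteq> 0"
      using psubset.IH[OF J(1) _ J(2,3)] by metis
    show ?thesis
      by (rule psubset.prems(1)[of J' \<beta>']) (use J J' in auto)
  next
    case False
    show ?thesis by (rule psubset.prems(1)[of I \<alpha>]) (use psubset.prems False in auto)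
  qed
qed

text \<open>As \<open>log 2 0 = 0\<close>, the empty set counts like a singleton, so
  \<open>q\<close> may be summed over all pairs.\<close>

abbreviation lg :: "nat set \<Rightarrow> real" where
  "lg A \<equiv> log 2 (real (card A))"

lemma lg_nonneg: "0 \<le> lg A"
  by (cases "card A = 0") (auto simp: log_def)

lemma lg_mono: "A \<subseteq> B \<Longrightarrow> finite B \<Longrightarrow> lg A \<le> lg B"
proof (cases "card A = 0")
  case True
  then show ?thesis using lg_nonneg[of B] by (simp add: log_def)
next
  case False
  assume "A \<subseteq> B" "finite B"
  then have "card A \<le> card B" by (simp add: card_mono)
  with False show ?thesis by simp
qed

lemma q_eq_lagr: "q (r, \<phi>, \<alpha>) = lagr {1..r} (\<lambda>e. lg (\<phi> e)) \<alpha>"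
proof -
  \<comment> \<open>Writing the weight as a product over e makes the summand a function of the
    unordered pair.\<close>
  let ?h = "\<lambda>e. (\<Prod>v\<in>e. \<alpha> v) * lg (\<phi> e)"
  have "(\<Sum>(i, j) \<in> {(i, j). 1 \<le> i \<and> i < j \<and> j \<le> r \<and> \<phi> {i, j} \<noteq> {}}. \<alpha> i * \<alpha> j * lg (\<phi> {i, j}))
      = (\<Sum>(i, j) \<in> {(i, j). 1 \<le> i \<and> i < j \<and> j \<le> r}. ?h {i, j})"
  proof (rule sum.mono_neutral_cong_left)
    have "{(i, j). 1 \<le> i \<and> i < j \<and> j \<le> r} \<subseteq> {1..r} \<times> {1..r}" by auto
    then show "finite {(i, j). 1 \<le> i \<and> i < j \<and> j \<le> r}" by (rule finite_subset) simp
  qed (auto simp: log_def)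
  also have "\<dots> = sum ?h ([{1..r}]\<^bsup>2\<^esup>)"
  proof -
    have "bij_betw (\<lambda>(i, j). {i, j}) {(i, j). 1 \<le> i \<and> i < j \<and> j \<le> r} ([{1..r}]\<^bsup>2\<^esup>)"
      unfolding bij_betw_def
    proof
      show "inj_on (\<lambda>(i, j). {i, j}) {(i, j). 1 \<le> i \<and> i < j \<and> j \<le> r}"
        by (auto simp: inj_on_def doubleton_eq_iff)
      show "(\<lambda>(i, j). {i, j}) ` {(i, j). 1 \<le> i \<and> i < j \<and> j \<le> r} = [{1..r}]\<^bsup>2\<^esup>"
      proof (intro equalityI subsetI)
        fix e assume "e \<in> [{1..r}]\<^bsup>2\<^esup>"
        then obtain x y where "e = {x, y}" "x \<in> {1..r}" "y \<in> {1..r}" "x \<noteq> y" by (elim nsets2_E)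
        then show "e \<in> (\<lambda>(i, j). {i, j}) ` {(i, j). 1 \<le> i \<and> i < j \<and> j \<le> r}"
          by (cases x y rule: linorder_cases)
             (auto simp: image_iff insert_commute intro!: bexI[of _ "(x, y)"] bexI[of _ "(y, x)"])
      qed auto
    qed
    from sum.reindex_bij_betw[OF this, of ?h] show ?thesis by (simp add: case_prod_unfold)
  qed
  also have "2 * \<dots> = (\<Sum>i\<in>{1..r}. \<Sum>j\<in>{1..r} - {i}. ?h {i, j})"
    by (rule sum_unordered_pairs[symmetric]) simp
  also have "\<dots> = lagr {1..r} (\<lambda>e. lg (\<phi> e)) \<alpha>"
    unfolding lagr_def by (intro sum.cong refl) auto
  finally show ?thesis by (simp add: q_def)
qed

section \<open>Attainment of the maximum\<close>

text \<open>Tychonoff: it is a closed subset of a product of compact sets.\<close>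

lemma compact_unit_simplex: "compact (unit_simplex r)"
proof -
  \<comment> \<open>Extensional functions are \<open>undefined\<close> off \<open>{1..r}\<close>, so
    these factors are single points.\<close>
  define X where "X = (\<lambda>i. if i \<in> {1..r} then {0..1} else {undefined :: real})"
  have "compactin (product_topology (\<lambda>i. euclidean) UNIV) (Pi\<^sub>E UNIV X)"
    by (subst compactin_PiE) (auto simp: X_def)
  then have "compact (Pi\<^sub>E UNIV X)"
    by (simp add: euclidean_product_topology)
  moreover have "closed {\<alpha>. (\<Sum>i = 1..r. \<alpha> i) = (1 :: real)}"
    by (intro closed_Collect_eq continuous_intros continuous_on_product_coordinates)
  moreover have "unit_simplex r = Pi\<^sub>E UNIV X \<inter> {\<alpha>. (\<Sum>i = 1..r. \<alpha> i) = 1}"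
  proof (intro equalityI subsetI)
    fix \<alpha> assume \<alpha>: "\<alpha> \<in> unit_simplex r"
    then have sum1: "(\<Sum>i = 1..r. \<alpha> i) = 1" and pe: "\<alpha> \<in> {1..r} \<rightarrow>\<^sub>E {0..}" by (auto simp: unit_simplex_def)
    have "\<alpha> i \<le> 1" if "i \<in> {1..r}" for i
      using member_le_sum[of i "{1..r}" \<alpha>] that pe sum1 by (auto simp: PiE_iff)
    then show "\<alpha> \<in> Pi\<^sub>E UNIV X \<inter> {\<alpha>. (\<Sum>i = 1..r. \<alpha> i) = 1}"
      using pe sum1 by (auto simp: X_def PiE_iff extensional_def)
  next
    fix \<alpha> assume "\<alpha> \<in> Pi\<^sub>E UNIV X \<inter> {\<alpha>. (\<Sum>i = 1..r. \<alpha> i) = 1}"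
    then have sum1: "(\<Sum>i = 1..r. \<alpha> i) = 1" and X: "\<And>i. \<alpha> i \<in> X i" by auto
    have "\<alpha> i \<ge> 0" if "i \<in> {1..r}" for i using X[of i] that by (simp add: X_def)
    moreover have "\<alpha> i = undefined" if "i \<notin> {1..r}" for i using X[of i] that by (simp only: X_def if_False singleton_iff)
    ultimately show "\<alpha> \<in> unit_simplex r"
      using sum1 by (simp add: unit_simplex_def PiE_iff extensional_def)
  qed
  ultimately show ?thesis by (simp add: compact_Int_closed)
qed

lemma q_attains_max_on_simplex:
  assumes "1 \<le> r"
  obtains \<alpha> where "\<alpha> \<in> unit_simplex r" "\<And>\<beta>. \<beta> \<in> unit_simplex r \<Longrightarrow> q (r, \<phi>, \<beta>) \<le> q (r, \<phi>, \<alpha>)"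
proof -
  have "(\<lambda>i\<in>{1..r}. of_bool (i = 1)) \<in> unit_simplex r"
    using assms by (auto simp: unit_simplex_def sum.delta)
  moreover have "continuous_on (unit_simplex r) (\<lambda>\<alpha>. q (r, \<phi>, \<alpha>))"
    unfolding q_eq_lagr lagr_def
    by (intro continuous_intros continuous_on_subset[OF continuous_on_product_coordinates subset_UNIV])
  ultimately show ?thesis
    using continuous_attains_sup[OF compact_unit_simplex[of r]] that by blast
qed

lemma finite_Phi: "finite (Phi t r s k)"
proof (rule finite_subset)
  show "Phi t r s k \<subseteq> [{1..r}]\<^bsup>2\<^esup> \<rightarrow>\<^sub>E Pow {1..s}" by (auto simp: Phi_def)
qed (auto intro!: finite_PiE finite_imp_finite_nsets)

lemma Phi_0_iff:
  "\<phi> \<in> Phi 0 r s k \<longleftrightarrow> \<phi> \<in> [{1..r}]\<^bsup>2\<^esup> \<rightarrow>\<^sub>E Pow {1..s} \<and> clique_free_map s k {1..r} \<phi>"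
  by (simp add: Phi_def clique_free_map_iff)

text \<open>There are finitely many pairs (r, \<phi>), and each attains its maximum over a compact
  simplex. As k c \<ge> 2, the one-vertex pattern is feasible, so \<open>GREATEST\<close> ranges
  over a nonempty set.\<close>

lemma Q_attained:
  fixes k :: "nat \<Rightarrow> nat"
  assumes k: "\<And>c. c \<in> {1..s} \<Longrightarrow> k c \<ge> 2"
  obtains r \<phi> \<alpha> where "(r, \<phi>, \<alpha>) \<in> FEAS 0 s k" "Q 0 s k = q (r, \<phi>, \<alpha>)"
    "\<And>x. x \<in> FEAS 0 s k \<Longrightarrow> q x \<le> Q 0 s k"
proof -
  define P where "P = (SIGMA r:{1..<ramsey_number s k}. Phi 0 r s k)"
  define m where "m = (\<lambda>(r, \<phi>). SOME \<alpha>. \<alpha> \<in> unit_simplex r \<and> (\<forall>\<beta>\<in>unit_simplex r. q (r, \<phi>, \<beta>) \<le> q (r, \<phi>, \<alpha>)))"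
  have m: "m (r, \<phi>) \<in> unit_simplex r \<and> (\<forall>\<beta>\<in>unit_simplex r. q (r, \<phi>, \<beta>) \<le> q (r, \<phi>, m (r, \<phi>)))" if "1 \<le> r" for r \<phi>
  proof -
    have "\<exists>\<alpha>. \<alpha> \<in> unit_simplex r \<and> (\<forall>\<beta>\<in>unit_simplex r. q (r, \<phi>, \<beta>) \<le> q (r, \<phi>, \<alpha>))"
      by (rule q_attains_max_on_simplex[OF that, of \<phi>]) blast
    then show ?thesis unfolding m_def prod.case by (rule someI_ex)
  qed
  have "[{1..1::nat}]\<^bsup>k c\<^esup> = {}" if "c \<in> {1..s}" for c
    using k[OF that] by (intro nsets_eq_empty) auto
  then have cf: "clique_free_map s k {1..1::nat} \<phi>" for \<phi>
    by (auto simp: clique_free_map_def)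
  have nsets1: "[{1..1::nat}]\<^bsup>2\<^esup> = {}" by (intro nsets_eq_empty) auto
  have "1 < ramsey_number s k"
    using card_less_ramsey_number[OF _ cf, of "\<lambda>_. {}"] nsets1 by simp
  \<comment> \<open>One vertex has no pairs, and this is the only extensional function on the empty
    set.\<close>
  moreover have "(\<lambda>_. undefined) \<in> Phi 0 1 s k"
    unfolding Phi_0_iff nsets1 using cf by simp
  ultimately have "(1, \<lambda>_. undefined) \<in> P" by (simp add: P_def)
  then have "P \<noteq> {}" by blast
  have "finite P" by (auto simp: P_def finite_Phi)
  let ?f = "\<lambda>x. q (fst x, snd x, m x)"
  obtain x where x: "x \<in> P" "\<And>y. y \<in> P \<Longrightarrow> ?f y \<le> ?f x"
  proof -
    have "Max (?f ` P) \<in> ?f ` P" using \<open>finite P\<close> \<open>P \<noteq> {}\<close> by (intro Max_in) auto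
    then obtain x where "x \<in> P" "?f x = Max (?f ` P)" by auto
    then show ?thesis using \<open>finite P\<close> by (intro that[of x]) auto
  qed
  obtain r \<phi> where r: "x = (r, \<phi>)" by (cases x)
  have F: "(r, \<phi>, m x) \<in> FEAS 0 s k"
    using x(1) m[of r \<phi>] by (auto simp: FEAS_def P_def r)
  have le: "q y \<le> q (r, \<phi>, m x)" if "y \<in> FEAS 0 s k" for y
  proof -
    obtain r' \<phi>' \<beta> where y: "y = (r', \<phi>', \<beta>)" by (cases y)
    have "q y \<le> ?f (r', \<phi>')"
      using that m[of r' \<phi>'] by (auto simp: y FEAS_def)
    also have "\<dots> \<le> ?f x"
      using that by (intro x) (auto simp: y FEAS_def P_def)
    finally show ?thesis by (simp add: r)
  qed
  have "Q 0 s k = q (r, \<phi>, m x)"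
    unfolding Q_def by (rule Greatest_equality) (use F le in auto)
  then show ?thesis using that[of r \<phi> "m x"] F le by simp
qed

text \<open>After \<open>lagr_reduce\<close> every remaining pair carries a colour, so the support
  is smaller than the Ramsey number and, renumbered, lies in \<open>FEAS\<close>. Hence I may have
  any finite size.\<close>

lemma lagr_le_Q:
  fixes k :: "nat \<Rightarrow> nat"
  assumes k: "\<And>c. c \<in> {1..s} \<Longrightarrow> k c \<ge> 2"
    and I: "finite I" and \<alpha>: "\<And>v. v \<in> I \<Longrightarrow> \<alpha> v \<ge> 0" "sum \<alpha> I = 1"
    and \<phi>: "clique_free_map s k I \<phi>" "\<And>e. e \<in> [I]\<^bsup>2\<^esup> \<Longrightarrow> \<phi> e \<subseteq> {1..s}"
  shows "lagr I (\<lambda>e. lg (\<phi> e)) \<alpha> \<le> Q 0 s k"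
proof -
  obtain J \<beta> where J: "J \<subseteq> I" "\<And>v. v \<in> J \<Longrightarrow> \<beta> v \<ge> 0" "sum \<beta> J = 1"
    "lagr I (\<lambda>e. lg (\<phi> e)) \<alpha> \<le> lagr J (\<lambda>e. lg (\<phi> e)) \<beta>" "\<And>e. e \<in> [J]\<^bsup>2\<^esup> \<Longrightarrow> lg (\<phi> e) \<noteq> 0"
    by (rule lagr_reduce[OF I, of \<alpha> "\<lambda>e. lg (\<phi> e)"]) (use \<alpha> in auto)
  have "finite J" using J I finite_subset by blast
  define r where "r = card J"
  have JI: "[J]\<^bsup>2\<^esup> \<subseteq> [I]\<^bsup>2\<^esup>" by (rule nsets_mono[OF J(1)])
  have ne: "\<phi> e \<noteq> {}" if "e \<in> [J]\<^bsup>2\<^esup>" for e using J(5)[OF that] by (auto simp: log_def)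
  have cfJ: "clique_free_map s k J \<phi>"
    using clique_free_map_pullback[OF \<phi>(1), of id J] J(1) by (simp add: id_def)
  have "r < ramsey_number s k"
    unfolding r_def using ne \<phi>(2) JI by (intro card_less_ramsey_number[OF \<open>finite J\<close> cfJ]) blast
  moreover have "1 \<le> r"
    using J(3) \<open>finite J\<close> by (auto simp: r_def Suc_le_eq card_gt_0_iff)
  moreover obtain b where b: "bij_betw b {1..r} J"
    using ex_bij_betw_nat_finite_1[OF \<open>finite J\<close>] by (auto simp: r_def)
  have inj: "inj_on b {1..r}" and img: "b ` {1..r} = J" using b by (auto simp: bij_betw_def)
  define \<phi>' where "\<phi>' = (\<lambda>e\<in>[{1..r}]\<^bsup>2\<^esup>. \<phi> (b ` e))"
  define \<beta>' where "\<beta>' = (\<lambda>i\<in>{1..r}. \<beta> (b i))"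
  have "clique_free_map s k {1..r} \<phi>'"
    by (rule clique_free_map_mono[OF clique_free_map_pullback[OF cfJ inj equalityD1[OF img]]]) (simp add: \<phi>'_def)
  moreover have "\<phi>' \<in> [{1..r}]\<^bsup>2\<^esup> \<rightarrow>\<^sub>E Pow {1..s}"
  proof -
    have "b ` e \<in> [I]\<^bsup>2\<^esup>" if "e \<in> [{1..r}]\<^bsup>2\<^esup>" for e
      using that inj img J(1) by (auto simp: nsets_def card_image inj_on_subset)
    then show ?thesis using \<phi>(2) by (auto simp: \<phi>'_def)
  qed
  ultimately have "\<phi>' \<in> Phi 0 r s k" by (simp add: Phi_0_iff)
  moreover have "sum \<beta>' {1..r} = sum \<beta> J"
    using sum.reindex_bij_betw[OF b, of \<beta>] by (simp add: \<beta>'_def)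
  then have "\<beta>' \<in> unit_simplex r"
    using J(2,3) img by (auto simp: unit_simplex_def \<beta>'_def)
  moreover have "lagr J (\<lambda>e. lg (\<phi> e)) \<beta> = q (r, \<phi>', \<beta>')"
  proof -
    have "lagr J (\<lambda>e. lg (\<phi> e)) \<beta> = (\<Sum>i\<in>{1..r}. \<Sum>j\<in>{1..r} - {i}. \<beta> (b i) * \<beta> (b j) * lg (\<phi> {b i, b j}))"
      unfolding lagr_def
    proof (subst sum.reindex_bij_betw[OF b, symmetric], intro sum.cong refl)
      fix i assume "i \<in> {1..r}"
      then have "bij_betw b ({1..r} - {i}) (J - {b i})"
        using bij_betw_DiffI[OF b, of "{i}" "{b i}"] img by auto
      from sum.reindex_bij_betw[OF this]
      show "(\<Sum>j\<in>J - {b i}. \<beta> (b i) * \<beta> j * lg (\<phi> {b i, j})) = (\<Sum>j\<in>{1..r} - {i}. \<beta> (b i) * \<beta> (b j) * lg (\<phi> {b i, b j}))"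
        by (rule sym)
    qed
    also have "\<dots> = q (r, \<phi>', \<beta>')"
      unfolding q_eq_lagr lagr_def by (intro sum.cong refl) (auto simp: \<phi>'_def \<beta>'_def)
    finally show ?thesis .
  qed
  moreover have "q x \<le> Q 0 s k" if "x \<in> FEAS 0 s k" for x
    by (rule Q_attained[OF k]) (use that in blast)+
  moreover from calculation have "(r, \<phi>', \<beta>') \<in> FEAS 0 s k"
    using \<open>1 \<le> r\<close> \<open>r < ramsey_number s k\<close> by (simp add: FEAS_def)
  ultimately show ?thesis using J(4) by (metis order_trans)
qed

lemma Q_nonneg:
  assumes "\<And>c. c \<in> {1..s} \<Longrightarrow> k c \<ge> 2"
  shows "0 \<le> Q 0 s k"
proof -
  obtain r \<phi> \<alpha> where F: "(r, \<phi>, \<alpha>) \<in> FEAS 0 s k" and eq: "Q 0 s k = q (r, \<phi>, \<alpha>)"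
    by (rule Q_attained[OF assms])
  have "0 \<le> q (r, \<phi>, \<alpha>)"
    unfolding q_eq_lagr lagr_def using F lg_nonneg
    by (intro sum_nonneg mult_nonneg_nonneg) (auto simp: FEAS_def unit_simplex_def PiE_iff)
  then show ?thesis using eq by simp
qed

section \<open>Lower bound\<close>

lemma finite_valid_colourings: "finite E \<Longrightarrow> finite (valid_colourings s k V E)"
  by (rule finite_subset[of _ "E \<rightarrow>\<^sub>E {1..s}"]) (auto simp: valid_colourings_def intro!: finite_PiE)

lemma F_graph_le_F_max: "E \<subseteq> [{1..n}]\<^bsup>2\<^esup> \<Longrightarrow> F_graph s k {1..n} E \<le> F_max s k n"
  unfolding F_max_def by (intro Max_ge) (auto simp: finite_imp_finite_nsets)

lemma F_max_attained:
  obtains E where "E \<subseteq> [{1..n}]\<^bsup>2\<^esup>" "F_max s k n = F_graph s k {1..n} E"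
proof -
  have "F_max s k n \<in> F_graph s k {1..n} ` Pow ([{1..n}]\<^bsup>2\<^esup>)"
    unfolding F_max_def by (intro Max_in) (auto simp: finite_imp_finite_nsets)
  then show ?thesis using that by auto
qed

lemma log2_prod_card:
  assumes "\<And>e. e \<in> E \<Longrightarrow> card (A e) > 0"
  shows "log 2 (real (\<Prod>e\<in>E. card (A e))) = (\<Sum>e\<in>E. lg (A e))"
  using assms
proof (induction E rule: infinite_finite_induct)
  case (insert e E)
  then have "real (\<Prod>e\<in>E. card (A e)) > 0" by (simp add: prod_pos)
  with insert show ?case by (simp add: log_mult)
qed auto

text \<open>A monochromatic clique in V would map injectively to one in R, since
  \<open>\<phi> {v} = {}\<close> leaves no edge inside a fibre of p. So every choice of permitted
  colours is valid, and the choices multiply.\<close>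

lemma graph_of_vertex_map:
  assumes V: "finite V" and \<phi>: "clique_free_map s k R \<phi>" "\<And>A. \<phi> A \<subseteq> {1..s}" "\<And>v. \<phi> {v} = {}"
    and p: "p ` V \<subseteq> R"
  obtains E where "E \<subseteq> [V]\<^bsup>2\<^esup>" "F_graph s k V E > 0"
    "(\<Sum>e\<in>[V]\<^bsup>2\<^esup>. lg (\<phi> (p ` e))) \<le> log 2 (real (F_graph s k V E))"
proof -
  define E where "E = {e \<in> [V]\<^bsup>2\<^esup>. \<phi> (p ` e) \<noteq> {}}"
  have E: "E \<subseteq> [V]\<^bsup>2\<^esup>" by (auto simp: E_def)
  have fin: "finite E" "finite ([V]\<^bsup>2\<^esup>)" using V by (auto simp: E_def finite_imp_finite_nsets)
  have sub: "(\<Pi>\<^sub>E e\<in>E. \<phi> (p ` e)) \<subseteq> valid_colourings s k V E"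
  proof
    fix \<sigma> assume \<sigma>: "\<sigma> \<in> (\<Pi>\<^sub>E e\<in>E. \<phi> (p ` e))"
    have "clique_free_map s k V (\<lambda>e. {c. e \<in> E \<and> \<sigma> e = c})"
      unfolding clique_free_map_def
    proof (intro ballI, rule ccontr)
      fix c H assume c: "c \<in> {1..s}" and H: "H \<in> [V]\<^bsup>k c\<^esup>"
        and "\<not> (\<exists>e\<in>[H]\<^bsup>2\<^esup>. c \<notin> {c. e \<in> E \<and> \<sigma> e = c})"
      then have *: "e \<in> E" "\<sigma> e = c" if "e \<in> [H]\<^bsup>2\<^esup>" for e using that by auto
      have col: "c \<in> \<phi> {p x, p y}" if "x \<in> H" "y \<in> H" "x \<noteq> y" for x y
        using *[of "{x, y}"] that \<sigma> by (force simp: PiE_iff)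
      have "inj_on p H"
        using col \<phi>(3) by (force simp: inj_on_def)
      then have "p ` H \<in> [R]\<^bsup>k c\<^esup>" using H p by (auto simp: nsets_def card_image)
      then obtain e where e: "e \<in> [p ` H]\<^bsup>2\<^esup>" "c \<notin> \<phi> e"
        using \<phi>(1) c unfolding clique_free_map_def by blast
      then obtain x y where "e = {p x, p y}" "x \<in> H" "y \<in> H" "p x \<noteq> p y" by (auto elim!: nsets2_E)
      then show False using e(2) col[of x y] by auto
    qed
    moreover have "\<sigma> \<in> E \<rightarrow>\<^sub>E {1..s}" using \<phi>(2) by (rule subsetD[OF PiE_mono \<sigma>])
    ultimately show "\<sigma> \<in> valid_colourings s k V E" unfolding valid_colourings_iff[OF E] by blast
  qed
  have pos: "card (\<phi> (p ` e)) > 0" if "e \<in> E" for e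
    using that finite_subset[OF \<phi>(2)] by (auto simp: E_def card_gt_0_iff)
  have le: "(\<Prod>e\<in>E. card (\<phi> (p ` e))) \<le> F_graph s k V E"
    unfolding F_graph_def using card_mono[OF finite_valid_colourings[OF fin(1)] sub] fin
    by (simp add: card_PiE)
  have pos': "(\<Prod>e\<in>E. card (\<phi> (p ` e))) > 0" using pos by (simp add: prod_pos)
  have "(\<Sum>e\<in>[V]\<^bsup>2\<^esup>. lg (\<phi> (p ` e))) = (\<Sum>e\<in>E. lg (\<phi> (p ` e)))"
    by (rule sum.mono_neutral_right) (use fin in \<open>auto simp: E_def log_def\<close>)
  also have "\<dots> = log 2 (real (\<Prod>e\<in>E. card (\<phi> (p ` e))))"
    using pos by (intro log2_prod_card[symmetric])
  also have "\<dots> \<le> log 2 (real (F_graph s k V E))"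
    using le pos' by (simp only: log_le_cancel_iff of_nat_0_less_iff of_nat_le_iff one_less_numeral_iff semiring_norm)
  finally show ?thesis using that[of E] E le pos' by linarith
qed

lemma F_max_lower_bound:
  assumes k: "\<And>c. c \<in> {1..s} \<Longrightarrow> k c \<ge> 2"
  shows "F_max s k n > 0" and "Q 0 s k * real (n choose 2) \<le> log 2 (real (F_max s k n))"
proof -
  obtain r \<phi> \<alpha> where F: "(r, \<phi>, \<alpha>) \<in> FEAS 0 s k" and eq: "Q 0 s k = q (r, \<phi>, \<alpha>)"
    by (rule Q_attained[OF k])
  have r: "1 \<le> r" and \<phi>: "\<phi> \<in> [{1..r}]\<^bsup>2\<^esup> \<rightarrow>\<^sub>E Pow {1..s}" "clique_free_map s k {1..r} \<phi>"
    and \<alpha>: "\<And>i. i \<in> {1..r} \<Longrightarrow> \<alpha> i \<ge> 0" "sum \<alpha> {1..r} = 1"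
    using F by (auto simp: FEAS_def Phi_0_iff unit_simplex_def)
  \<comment> \<open>Off the pairs \<phi> is \<open>undefined\<close>. Making \<psi> empty there
    ensures that vertices with the same image are not joined and contribute 0.\<close>
  define \<psi> where "\<psi> = (\<lambda>A. if A \<in> [{1..r}]\<^bsup>2\<^esup> then \<phi> A else {})"
  have \<psi>: "clique_free_map s k {1..r} \<psi>" "\<And>A. \<psi> A \<subseteq> {1..s}" "\<And>v. \<psi> {v} = {}"
    using clique_free_map_mono[OF \<phi>(2), of \<psi>] \<phi>(1) by (auto simp: \<psi>_def nsets_def)
  \<comment> \<open>With a zero diagonal, Q is exactly the expected \<open>lg\<close> at two
    independent points, so the bound has no error term.\<close>
  have Q_eq: "Q 0 s k = (\<Sum>i\<in>{1..r}. \<Sum>j\<in>{1..r}. \<alpha> i * \<alpha> j * lg (\<psi> {i, j}))"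
    unfolding eq q_eq_lagr lagr_def
  proof (rule sum.cong[OF refl])
    fix i assume i: "i \<in> {1..r}"
    have "(\<Sum>j\<in>{1..r}. \<alpha> i * \<alpha> j * lg (\<psi> {i, j})) = (\<Sum>j\<in>{1..r} - {i}. \<alpha> i * \<alpha> j * lg (\<psi> {i, j}))"
      using i by (simp add: sum.remove[of _ i] \<psi>(3) log_def)
    also have "\<dots> = (\<Sum>j\<in>{1..r} - {i}. \<alpha> i * \<alpha> j * lg (\<phi> {i, j}))"
      using i by (intro sum.cong refl) (auto simp: \<psi>_def)
    finally show "(\<Sum>j\<in>{1..r} - {i}. \<alpha> i * \<alpha> j * lg (\<phi> {i, j})) = (\<Sum>j\<in>{1..r}. \<alpha> i * \<alpha> j * lg (\<psi> {i, j}))"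
      by simp
  qed
  define V where "V = {1..n}"
  define S where "S = (\<lambda>p. \<Sum>e\<in>[V]\<^bsup>2\<^esup>. lg (\<psi> (p ` e)))"
  have "pexp V {1..r} \<alpha> S = (\<Sum>e\<in>[V]\<^bsup>2\<^esup>. Q 0 s k)"
    unfolding S_def pexp_sum
  proof (rule sum.cong[OF refl])
    fix e assume "e \<in> [V]\<^bsup>2\<^esup>"
    then obtain x y where "e = {x, y}" "x \<in> V" "y \<in> V" "x \<noteq> y" by (elim nsets2_E)
    then show "pexp V {1..r} \<alpha> (\<lambda>p. lg (\<psi> (p ` e))) = Q 0 s k"
      using pexp_two_coordinates[of V "{1..r}" x y \<alpha> "\<lambda>a b. lg (\<psi> {a, b})"] \<alpha>(2)
      by (simp add: Q_eq V_def)
  qed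
  then have ES: "pexp V {1..r} \<alpha> S = Q 0 s k * real (n choose 2)"
    by (simp add: V_def mult.commute)
  \<comment> \<open>The best map does at least as well as the average one.\<close>
  define M where "M = Max (S ` (V \<rightarrow>\<^sub>E {1..r}))"
  have fin: "finite (V \<rightarrow>\<^sub>E {1..r})" "V \<rightarrow>\<^sub>E {1..r} \<noteq> {}"
    using r by (auto simp: V_def PiE_eq_empty_iff intro!: finite_PiE)
  have "pexp V {1..r} \<alpha> S \<le> pexp V {1..r} \<alpha> (\<lambda>_. M)"
    using \<alpha>(1) fin by (intro pexp_mono) (auto simp: M_def)
  also have "\<dots> = M" using \<alpha>(2) by (intro pexp_const) (auto simp: V_def)
  finally have le: "Q 0 s k * real (n choose 2) \<le> M" using ES by simp
  have "M \<in> S ` (V \<rightarrow>\<^sub>E {1..r})" unfolding M_def using fin by (intro Max_in) auto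
  then obtain p where p: "p \<in> V \<rightarrow>\<^sub>E {1..r}" "M = S p" by auto
  have "p ` V \<subseteq> {1..r}" using p by auto
  then obtain E where E: "E \<subseteq> [V]\<^bsup>2\<^esup>" "F_graph s k V E > 0" "S p \<le> log 2 (real (F_graph s k V E))"
    using graph_of_vertex_map[OF _ \<psi>, of V p] unfolding S_def V_def by (metis finite_atLeastAtMost)
  have "F_graph s k V E \<le> F_max s k n" using F_graph_le_F_max E by (simp add: V_def)
  moreover from this E show "F_max s k n > 0" by linarith
  ultimately have "log 2 (real (F_graph s k V E)) \<le> log 2 (real (F_max s k n))"
    using E by simp
  then show "Q 0 s k * real (n choose 2) \<le> log 2 (real (F_max s k n))"
    using le p E by linarith
qed

section \<open>Templates\<close>

text \<open>Exponential weights: a colour outside \<open>\<Phi> e\<close> weighs z, so each counted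
  colouring weighs at least z ^ b, while the total weight of all colourings factorises over the
  edges.\<close>

lemma card_near_template:
  assumes E: "finite E" and z: "0 < z" "z \<le> 1" and \<Phi>: "\<And>e. e \<in> E \<Longrightarrow> \<Phi> e \<subseteq> {1..s}"
  shows "real (card {\<sigma> \<in> E \<rightarrow>\<^sub>E {1..s}. card {e \<in> E. \<sigma> e \<notin> \<Phi> e} \<le> b}) * z ^ b
    \<le> (\<Prod>e\<in>E. real (card (\<Phi> e)) + z * real s)"
proof -
  let ?N = "{\<sigma> \<in> E \<rightarrow>\<^sub>E {1..s}. card {e \<in> E. \<sigma> e \<notin> \<Phi> e} \<le> b}"
  define w where "w = (\<lambda>e c. if c \<in> \<Phi> e then 1 else z)"
  have fin: "finite (E \<rightarrow>\<^sub>E {1..s})" using E by (intro finite_PiE) auto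
  have "real (card ?N) * z ^ b = (\<Sum>\<sigma>\<in>?N. z ^ b)" by simp
  also have "\<dots> \<le> (\<Sum>\<sigma>\<in>?N. \<Prod>e\<in>E. w e (\<sigma> e))"
  proof (rule sum_mono)
    fix \<sigma> assume \<sigma>: "\<sigma> \<in> ?N"
    have "(\<Prod>e\<in>E. w e (\<sigma> e)) = z ^ card {e \<in> E. \<sigma> e \<notin> \<Phi> e}"
      unfolding w_def using E by (simp add: prod.If_cases) (simp add: Int_def conj_commute)
    then show "z ^ b \<le> (\<Prod>e\<in>E. w e (\<sigma> e))"
      using \<sigma> z by (simp add: power_decreasing)
  qed
  also have "\<dots> \<le> (\<Sum>\<sigma>\<in>E \<rightarrow>\<^sub>E {1..s}. \<Prod>e\<in>E. w e (\<sigma> e))"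
    using fin z by (intro sum_mono2) (auto simp: w_def intro!: prod_nonneg)
  also have "\<dots> = (\<Prod>e\<in>E. \<Sum>c\<in>{1..s}. w e c)"
    using E by (intro prod_sum_PiE[symmetric]) auto
  also have "\<dots> \<le> (\<Prod>e\<in>E. real (card (\<Phi> e)) + z * real s)"
  proof (intro prod_mono conjI)
    fix e assume e: "e \<in> E"
    show "0 \<le> (\<Sum>c\<in>{1..s}. w e c)" using z by (intro sum_nonneg) (auto simp: w_def)
    have "(\<Sum>c\<in>{1..s}. w e c) \<le> (\<Sum>c\<in>{1..s}. of_bool (c \<in> \<Phi> e) + z)"
      using z by (intro sum_mono) (auto simp: w_def)
    also have "\<dots> = real (card ({1..s} \<inter> \<Phi> e)) + z * real s"
      by (simp add: sum.distrib Int_def)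
    also have "{1..s} \<inter> \<Phi> e = \<Phi> e" using \<Phi>[OF e] by auto
    finally show "(\<Sum>c\<in>{1..s}. w e c) \<le> real (card (\<Phi> e)) + z * real s" .
  qed
  finally show ?thesis .
qed

lemma log2_add_le: "x \<ge> 0 \<Longrightarrow> log 2 (1 + x) \<le> 2 * x"
proof -
  assume x: "x \<ge> 0"
  have "ln (1 + x) \<le> x" using x by (rule ln_add_one_self_le_self)
  moreover have "x \<le> 2 * x * ln 2" using mult_left_mono[OF ln2_ge_two_thirds x] x by linarith
  ultimately show ?thesis by (simp add: log_def divide_le_eq)
qed

lemma card_near_template_powr:
  assumes E: "finite E" and z: "0 < z" "z \<le> 1" and \<Phi>: "\<And>e. e \<in> E \<Longrightarrow> \<Phi> e \<subseteq> {1..s}"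
  shows "real (card {\<sigma> \<in> E \<rightarrow>\<^sub>E {1..s}. card {e \<in> E. \<sigma> e \<notin> \<Phi> e} \<le> b})
    \<le> 2 powr (real b * log 2 (1 / z) + (\<Sum>e\<in>E. lg (\<Phi> e)) + 2 * z * real s * real (card E))"
proof -
  let ?N = "real (card {\<sigma> \<in> E \<rightarrow>\<^sub>E {1..s}. card {e \<in> E. \<sigma> e \<notin> \<Phi> e} \<le> b})"
  have "?N * z ^ b \<le> (\<Prod>e\<in>E. real (card (\<Phi> e)) + z * real s)"
    by (rule card_near_template[OF assms])
  also have "\<dots> \<le> (\<Prod>e\<in>E. 2 powr (lg (\<Phi> e) + 2 * z * real s))"
  proof (intro prod_mono conjI)
    fix e assume "e \<in> E"
    have 1: "real (card (\<Phi> e)) \<le> 2 powr lg (\<Phi> e)" by (cases "card (\<Phi> e) = 0") auto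
    \<comment> \<open>This holds even for an empty \<open>\<Phi> e\<close>, as
      \<open>lg {} = 0\<close>, and lets z s be absorbed as a factor 1 + z s.\<close>
    have 2: "1 \<le> 2 powr lg (\<Phi> e)" using lg_nonneg[of "\<Phi> e"] by (intro ge_one_powr_ge_zero) auto
    have "1 + z * real s = 2 powr log 2 (1 + z * real s)" using z by (simp add: add_pos_nonneg)
    also have "\<dots> \<le> 2 powr (2 * z * real s)" using log2_add_le[of "z * real s"] z by simp
    finally have 3: "1 + z * real s \<le> 2 powr (2 * z * real s)" .
    have "real (card (\<Phi> e)) + z * real s \<le> 2 powr lg (\<Phi> e) + 2 powr lg (\<Phi> e) * (z * real s)"
    proof -
      have "1 * (z * real s) \<le> 2 powr lg (\<Phi> e) * (z * real s)"
        using z by (intro mult_right_mono 2) auto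
      with 1 show ?thesis by linarith
    qed
    also have "\<dots> = 2 powr lg (\<Phi> e) * (1 + z * real s)" by (simp add: algebra_simps)
    also have "\<dots> \<le> 2 powr lg (\<Phi> e) * 2 powr (2 * z * real s)"
      using 3 by (intro mult_left_mono) auto
    finally show "real (card (\<Phi> e)) + z * real s \<le> 2 powr (lg (\<Phi> e) + 2 * z * real s)"
      by (simp add: powr_add)
  qed (use z in auto)
  also have "\<dots> = 2 powr (\<Sum>e\<in>E. lg (\<Phi> e) + 2 * z * real s)"
    by (simp add: powr_sum)
  also have "(\<Sum>e\<in>E. lg (\<Phi> e) + 2 * z * real s) = (\<Sum>e\<in>E. lg (\<Phi> e)) + 2 * z * real s * real (card E)"
    by (simp add: sum.distrib)
  finally have "?N * z ^ b \<le> 2 powr ((\<Sum>e\<in>E. lg (\<Phi> e)) + 2 * z * real s * real (card E))" (is "_ \<le> 2 powr ?X") .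
  then have "?N \<le> 2 powr ?X * (1 / z ^ b)"
    using z by (simp add: field_simps)
  also have "1 / z ^ b = 2 powr (real b * log 2 (1 / z))"
    using z by (simp add: powr_powr[symmetric] mult.commute[of "real b"] powr_realpow power_divide)
  finally show ?thesis by (simp add: powr_add mult_ac)
qed

definition ordered_pairs :: "nat set \<Rightarrow> (nat \<times> nat) set" where
  "ordered_pairs H = {(i, j). i \<in> H \<and> j \<in> H \<and> i < j}"

lemma ordered_pairs_bound:
  assumes "H \<subseteq> {1..m}"
  shows "finite (ordered_pairs H)" "card (ordered_pairs H) \<le> m\<^sup>2"
proof -
  have sub: "ordered_pairs H \<subseteq> {1..m} \<times> {1..m}" using assms by (auto simp: ordered_pairs_def)
  then show "finite (ordered_pairs H)" by (rule finite_subset) simp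
  show "card (ordered_pairs H) \<le> m\<^sup>2"
    using card_mono[OF _ sub] by (simp add: card_cartesian_product power2_eq_square)
qed

text \<open>The set of colours that are dense between the blocks \<open>p x\<close> and \<open>p y\<close>, as a function of the
  label \<open>{p x, p y}\<close>; the templates of all colourings thus come from a set of size \<open>2\<^bsup>O(n)\<^esup>\<close>.\<close>

definition dense_colours ::
  "nat \<Rightarrow> 'a set \<Rightarrow> ('a \<Rightarrow> nat) \<Rightarrow> (nat \<Rightarrow> 'a set \<Rightarrow> real) \<Rightarrow> real \<Rightarrow> nat set \<Rightarrow> nat set" where
  "dense_colours s V p G \<delta> L =
     {c \<in> {1..s}. \<exists>x\<in>V. \<exists>y\<in>V. {p x, p y} = L \<and> \<delta> < block_density V p (G c) (x, y)}"

text \<open>Block densities depend on the label alone, so any representatives of it will do.\<close>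

lemma mem_dense_colours_iff:
  assumes "x \<in> V" "y \<in> V"
  shows "c \<in> dense_colours s V p G \<delta> {p x, p y} \<longleftrightarrow> c \<in> {1..s} \<and> \<delta> < block_density V p (G c) (x, y)"
proof -
  have "block_density V p (G c) (x', y') = block_density V p (G c) (x, y)" if "{p x', p y'} = {p x, p y}" for x' y'
    unfolding block_density_def using that by (intro cexp_measurable) simp
  then have "\<delta> < block_density V p (G c) (x, y)"
    if "{p x', p y'} = {p x, p y}" "\<delta> < block_density V p (G c) (x', y')" for x' y'
    using that by metis
  then show ?thesis using assms by (auto simp only: dense_colours_def mem_Collect_eq)
qed

text \<open>Being sparse is constant on blocks, so G may be replaced by its block average, which is
  at most \<delta> there.\<close>

lemma sum_sparse_le:
  assumes V: "finite V" and G: "\<And>e. 0 \<le> G e" "\<And>e. G e \<le> 1" and "0 \<le> \<delta>"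
  shows "(\<Sum>x\<in>V. \<Sum>y\<in>V. G {x, y} * of_bool (block_density V p G (x, y) \<le> \<delta>)) \<le> \<delta> * real (card V) ^ 2"
proof -
  let ?g = "block_density V p G"
  have "(\<Sum>x\<in>V. \<Sum>y\<in>V. G {x, y} * of_bool (?g (x, y) \<le> \<delta>))
      = (\<Sum>w\<in>V \<times> V. (\<lambda>(x, y). G {x, y}) w * of_bool (?g w \<le> \<delta>))"
    by (simp add: sum.cartesian_product case_prod_unfold)
  also have "\<dots> = (\<Sum>w\<in>V \<times> V. ?g w * of_bool (?g w \<le> \<delta>))"
  proof -
    have meas: "of_bool (?g v \<le> \<delta>) = (of_bool (?g w \<le> \<delta>) :: real)"
      if "(\<lambda>(x, y). {p x, p y}) v = (\<lambda>(x, y). {p x, p y}) w" for v w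
      unfolding block_density_def cexp_measurable[of "\<lambda>(x, y). {p x, p y}" v w, OF that] ..
    show ?thesis
      by (rule sum_cexp_mult[of "V \<times> V" "\<lambda>(x, y). {p x, p y}" "\<lambda>w. of_bool (?g w \<le> \<delta>)" "\<lambda>(x, y). G {x, y}",
            folded block_density_def, symmetric]) (use V in simp, rule meas)
  qed
  also have "\<dots> \<le> (\<Sum>w\<in>V \<times> V. \<delta>)"
    using \<open>0 \<le> \<delta>\<close> by (intro sum_mono) auto
  finally show ?thesis by (simp add: card_cartesian_product power2_eq_square mult.commute)
qed

definition colour_indicator :: "'a set set \<Rightarrow> ('a set \<Rightarrow> nat) \<Rightarrow> nat \<Rightarrow> 'a set \<Rightarrow> real" where
  "colour_indicator E \<sigma> c e = of_bool (e \<in> E \<and> \<sigma> e = c)"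

lemma colour_indicator_range: "0 \<le> colour_indicator E \<sigma> c e" "colour_indicator E \<sigma> c e \<le> 1"
  by (auto simp: colour_indicator_def)

text \<open>An edge whose colour is missing from the template lies in a block that is sparse for
  that very colour, and sparse blocks hold few edges of the colour.\<close>

lemma template_few_exceptions:
  fixes V :: "'a set" and p :: "'a \<Rightarrow> nat"
  assumes V: "finite V" and E: "E \<subseteq> [V]\<^bsup>2\<^esup>" and \<sigma>: "\<sigma> \<in> E \<rightarrow>\<^sub>E {1..s}" and "0 \<le> \<delta>"
  defines "\<Phi> \<equiv> \<lambda>e. dense_colours s V p (colour_indicator E \<sigma>) \<delta> (p ` e)"
  shows "real (card {e \<in> E. \<sigma> e \<notin> \<Phi> e}) \<le> \<delta> * real s * real (card V) ^ 2"
proof -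
  let ?G = "colour_indicator E \<sigma>"
  let ?bad = "\<lambda>e. of_bool (e \<in> E \<and> \<sigma> e \<notin> \<Phi> e) :: real"
  let ?t = "\<lambda>c x y. ?G c {x, y} * of_bool (block_density V p (?G c) (x, y) \<le> \<delta>)"
  have "real (card {e \<in> E. \<sigma> e \<notin> \<Phi> e}) = sum ?bad ([V]\<^bsup>2\<^esup>)"
  proof -
    have "[V]\<^bsup>2\<^esup> \<inter> {e. e \<in> E \<and> \<sigma> e \<notin> \<Phi> e} = {e \<in> E. \<sigma> e \<notin> \<Phi> e}" using E by auto
    then show ?thesis using V by (simp add: finite_imp_finite_nsets)
  qed
  also have "\<dots> \<le> 2 * sum ?bad ([V]\<^bsup>2\<^esup>)"
    using sum_nonneg[of "[V]\<^bsup>2\<^esup>" ?bad] by simp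
  also have "\<dots> = (\<Sum>x\<in>V. \<Sum>y\<in>V - {x}. ?bad {x, y})"
    by (rule sum_unordered_pairs[OF V, symmetric])
  also have "\<dots> \<le> (\<Sum>x\<in>V. \<Sum>y\<in>V. \<Sum>c\<in>{1..s}. ?t c x y)"
  proof (rule sum_mono)
    fix x assume x: "x \<in> V"
    have "(\<Sum>y\<in>V - {x}. ?bad {x, y}) \<le> (\<Sum>y\<in>V. ?bad {x, y})"
      using V by (intro sum_mono2) auto
    also have "\<dots> \<le> (\<Sum>y\<in>V. \<Sum>c\<in>{1..s}. ?t c x y)"
    proof (rule sum_mono)
      fix y assume y: "y \<in> V"
      have nn: "0 \<le> ?t c x y" for c by (simp add: colour_indicator_def)
      show "?bad {x, y} \<le> (\<Sum>c\<in>{1..s}. ?t c x y)"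
      proof (cases "{x, y} \<in> E \<and> \<sigma> {x, y} \<notin> \<Phi> {x, y}")
        case True
        then have c: "\<sigma> {x, y} \<in> {1..s}" using \<sigma> by auto
        with True have "block_density V p (?G (\<sigma> {x, y})) (x, y) \<le> \<delta>"
          using mem_dense_colours_iff[OF x y, of "\<sigma> {x, y}" s p ?G \<delta>] by (auto simp: \<Phi>_def)
        with True have "?t (\<sigma> {x, y}) x y = 1" by (simp add: colour_indicator_def)
        moreover have "?t (\<sigma> {x, y}) x y \<le> (\<Sum>c\<in>{1..s}. ?t c x y)"
          using c nn by (intro member_le_sum) auto
        ultimately show ?thesis using True by simp
      next
        case False
        then have "?bad {x, y} = 0" by simp
        then show ?thesis using nn by (simp only: sum_nonneg)
      qed
    qed
    finally show "(\<Sum>y\<in>V - {x}. ?bad {x, y}) \<le> (\<Sum>y\<in>V. \<Sum>c\<in>{1..s}. ?t c x y)" .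
  qed
  also have "\<dots> = (\<Sum>x\<in>V. \<Sum>c\<in>{1..s}. \<Sum>y\<in>V. ?t c x y)"
    by (intro sum.cong refl sum.swap)
  also have "\<dots> = (\<Sum>c\<in>{1..s}. \<Sum>x\<in>V. \<Sum>y\<in>V. ?t c x y)"
    by (rule sum.swap)
  also have "\<dots> \<le> (\<Sum>c\<in>{1..s}. \<delta> * real (card V) ^ 2)"
    using V \<open>0 \<le> \<delta>\<close> by (intro sum_mono sum_sparse_le colour_indicator_range)
  finally show ?thesis by (simp add: mult_ac)
qed

text \<open>Union bound over the colours c and the sets of k c sample positions, with
  \<open>few_dense_cliques\<close> for each: the colouring itself has no such clique.\<close>

lemma template_few_cliques:
  fixes V :: "'a set" and p :: "'a \<Rightarrow> nat"
  assumes V: "finite V" "V \<noteq> {}" and E: "E \<subseteq> [V]\<^bsup>2\<^esup>" and \<sigma>: "\<sigma> \<in> valid_colourings s k V E"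
    and \<delta>: "0 < \<delta>" "\<delta> \<le> 1" and "0 \<le> \<epsilon>"
    and reg: "\<And>c. c \<in> {1..s} \<Longrightarrow> cut_regular V \<epsilon> p (colour_indicator E \<sigma> c)"
  defines "\<Phi> \<equiv> \<lambda>e. dense_colours s V p (colour_indicator E \<sigma>) \<delta> (p ` e)"
  shows "uexp {1..m} V (\<lambda>x. of_bool (\<not> clique_free_map s k {1..m} (\<lambda>e. \<Phi> (x ` e))))
    \<le> real s * 2 ^ m * (real (m\<^sup>2) * \<epsilon> / \<delta> ^ m\<^sup>2)"
proof -
  let ?G = "colour_indicator E \<sigma>"
  let ?g = "\<lambda>c x y. block_density V p (?G c) (x, y)"
  let ?I = "{1..m}"
  let ?Z = "real (m\<^sup>2) * \<epsilon> / \<delta> ^ m\<^sup>2"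
  let ?dc = "\<lambda>c H x. of_bool (\<forall>(i, j)\<in>ordered_pairs H. \<delta> < ?g c (x i) (x j)) :: real"
  have Hsub: "H \<subseteq> ?I" if "H \<in> [?I]\<^bsup>k c\<^esup>" for c H using that by (auto simp: nsets_def)
  have fin: "finite ([?I]\<^bsup>k c\<^esup>)" for c by (simp add: finite_imp_finite_nsets)
  have bad_le: "of_bool (\<not> clique_free_map s k ?I (\<lambda>e. \<Phi> (x ` e))) \<le> (\<Sum>c\<in>{1..s}. \<Sum>H\<in>[?I]\<^bsup>k c\<^esup>. ?dc c H x)"
    if x: "x \<in> ?I \<rightarrow>\<^sub>E V" for x
  proof (cases "clique_free_map s k ?I (\<lambda>e. \<Phi> (x ` e))")
    case True
    then show ?thesis by (simp add: sum_nonneg)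
  next
    case False
    then obtain c H where c: "c \<in> {1..s}" and H: "H \<in> [?I]\<^bsup>k c\<^esup>"
      and all: "\<And>e. e \<in> [H]\<^bsup>2\<^esup> \<Longrightarrow> c \<in> \<Phi> (x ` e)"
      unfolding clique_free_map_def by blast
    have "\<delta> < ?g c (x i) (x j)" if "(i, j) \<in> ordered_pairs H" for i j
    proof -
      have ij: "i \<in> H" "j \<in> H" "i \<noteq> j" using that by (auto simp: ordered_pairs_def)
      then have "x i \<in> V" "x j \<in> V" using Hsub[OF H] x by auto
      with all[of "{i, j}"] ij show ?thesis
        by (simp add: \<Phi>_def mem_dense_colours_iff)
    qed
    then have "?dc c H x = 1" by auto
    then have "1 \<le> (\<Sum>H\<in>[?I]\<^bsup>k c\<^esup>. ?dc c H x)"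
      using member_le_sum[OF H, of "\<lambda>H. ?dc c H x"] fin by simp
    also have "\<dots> \<le> (\<Sum>c\<in>{1..s}. \<Sum>H\<in>[?I]\<^bsup>k c\<^esup>. ?dc c H x)"
      using member_le_sum[OF c, of "\<lambda>c. \<Sum>H\<in>[?I]\<^bsup>k c\<^esup>. ?dc c H x"] by (simp add: sum_nonneg)
    finally show ?thesis using False by simp
  qed
  have dc: "uexp ?I V (?dc c H) \<le> ?Z" if c: "c \<in> {1..s}" and H: "H \<in> [?I]\<^bsup>k c\<^esup>" for c H
  proof -
    note A = ordered_pairs_bound[OF Hsub[OF H]]
    have "uexp ?I V (?dc c H) \<le> real (card (ordered_pairs H)) * \<epsilon> / \<delta> ^ card (ordered_pairs H)"
    proof (rule few_dense_cliques[where f = "\<lambda>x y. ?G c {x, y}"])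
      show "(\<Sum>x\<in>S. \<Sum>y\<in>T. ?g c x y - ?G c {x, y}) \<le> \<epsilon> * real (card V) ^ 2" if "S \<subseteq> V" "T \<subseteq> V" for S T
        using reg[OF c] that by (auto simp: cut_regular_def)
      show "ordered_pairs H \<subseteq> {(i, j). i \<in> ?I \<and> j \<in> ?I \<and> i < j}"
        using Hsub[OF H] by (auto simp: ordered_pairs_def)
      fix x assume x: "x \<in> ?I \<rightarrow>\<^sub>E V"
      show "\<exists>(i, j)\<in>ordered_pairs H. ?G c {x i, x j} = 0"
      proof (rule ccontr)
        assume neg: "\<not> ?thesis"
        have edge: "{x i, x j} \<in> E \<and> \<sigma> {x i, x j} = c" if "i \<in> H" "j \<in> H" "i < j" for i j
          using neg that by (auto simp: ordered_pairs_def colour_indicator_def split: if_splits)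
        have edge': "{x i, x j} \<in> E \<and> \<sigma> {x i, x j} = c" if "i \<in> H" "j \<in> H" "i \<noteq> j" for i j
          using edge[of i j] edge[of j i] that by (cases i j rule: linorder_cases) (auto simp: insert_commute)
        \<comment> \<open>A repeated vertex would give a singleton edge, so degenerate tuples are
          excluded too.\<close>
        have "inj_on x H"
        proof (rule inj_onI, rule ccontr)
          fix i j assume "i \<in> H" "j \<in> H" "x i = x j" "i \<noteq> j"
          then have "{x i} \<in> E" using edge'[of i j] by simp
          then show False using E by (auto simp: nsets_def)
        qed
        then have "x ` H \<in> [V]\<^bsup>k c\<^esup>"
          using H Hsub[OF H] x by (auto simp: nsets_def card_image)
        moreover have "clique_free_map s k V (\<lambda>e. {c. e \<in> E \<and> \<sigma> e = c})"
          using \<sigma> valid_colourings_iff[OF E] by blast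
        ultimately obtain e where e: "e \<in> [x ` H]\<^bsup>2\<^esup>" "\<not> (e \<in> E \<and> \<sigma> e = c)"
          using c unfolding clique_free_map_def by blast
        then obtain i j where "e = {x i, x j}" "i \<in> H" "j \<in> H" "x i \<noteq> x j" by (auto elim!: nsets2_E)
        then show False using e(2) edge'[of i j] by auto
      qed
    qed (use V A \<delta> in \<open>auto simp: colour_indicator_range block_density_range\<close>)
    \<comment> \<open>As \<delta> \<le> 1, replacing the number of pairs by m^2 only enlarges the
      quotient.\<close>
    also have "\<dots> \<le> ?Z"
      using A \<delta> \<open>0 \<le> \<epsilon>\<close>
      by (intro frac_le mult_mono power_decreasing) (auto simp: zero_less_power simp flip: of_nat_power)
    finally show ?thesis .
  qed
  have "uexp ?I V (\<lambda>x. of_bool (\<not> clique_free_map s k ?I (\<lambda>e. \<Phi> (x ` e))))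
      \<le> uexp ?I V (\<lambda>x. \<Sum>c\<in>{1..s}. \<Sum>H\<in>[?I]\<^bsup>k c\<^esup>. ?dc c H x)"
    by (rule pexp_mono) (simp, rule bad_le)
  also have "\<dots> = (\<Sum>c\<in>{1..s}. \<Sum>H\<in>[?I]\<^bsup>k c\<^esup>. uexp ?I V (?dc c H))"
    by (simp only: pexp_sum)
  also have "\<dots> \<le> (\<Sum>c\<in>{1..s}. \<Sum>H\<in>[?I]\<^bsup>k c\<^esup>. ?Z)"
    by (intro sum_mono dc)
  also have "\<dots> \<le> (\<Sum>c\<in>{1..s}. 2 ^ m * ?Z)"
  proof (rule sum_mono)
    fix c
    have "card ([?I]\<^bsup>k c\<^esup>) \<le> card (Pow ?I)"
      by (rule card_mono) (auto simp: nsets_def)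
    then have "real (card ([?I]\<^bsup>k c\<^esup>)) \<le> 2 ^ m" by (simp add: card_Pow del: card_nsets)
    moreover have "0 \<le> ?Z" using \<delta> \<open>0 \<le> \<epsilon>\<close> by simp
    ultimately show "(\<Sum>H\<in>[?I]\<^bsup>k c\<^esup>. ?Z) \<le> 2 ^ m * ?Z"
      unfolding sum_constant by (rule mult_right_mono)
  qed
  finally show ?thesis by (simp add: mult_ac)
qed

text \<open>Sampling \<open>m\<close> vertices: outside an event of small probability the template pulls back to a
  clique-free pattern on \<open>{1..m}\<close> with uniform weights, whose value is at most \<open>Q\<close>.\<close>

lemma sum_lg_template_le:
  fixes k :: "nat \<Rightarrow> nat"
  assumes k: "\<And>c. c \<in> {1..s} \<Longrightarrow> k c \<ge> 2" and V: "finite V" "V \<noteq> {}" and m: "1 \<le> m"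
    and \<Phi>: "\<And>e. \<Phi> e \<subseteq> {1..s}"
    and few: "uexp {1..m} V (\<lambda>x. of_bool (\<not> clique_free_map s k {1..m} (\<lambda>e. \<Phi> (x ` e)))) \<le> \<gamma>"
  shows "(real m - 1) * (\<Sum>x\<in>V. \<Sum>y\<in>V. lg (\<Phi> {x, y})) \<le> real m * (Q 0 s k + lg {1..s} * \<gamma>) * real (card V) ^ 2"
proof -
  let ?I = "{1..m}"
  define n where "n = real (card V)"
  have n: "n > 0" using V by (auto simp: n_def card_gt_0_iff)
  define S where "S = (\<Sum>x\<in>V. \<Sum>y\<in>V. lg (\<Phi> {x, y}))"
  have one: "(\<Sum>_\<in>V. 1 / real (card V)) = 1" using V by simp
  let ?u = "\<lambda>_. 1 / real m"
  let ?L = "\<lambda>x. lagr ?I (\<lambda>e. lg (\<Phi> (x ` e))) ?u"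
  let ?B = "\<lambda>x. of_bool (\<not> clique_free_map s k ?I (\<lambda>e. \<Phi> (x ` e))) :: real"
  have L_le: "?L x \<le> Q 0 s k + lg {1..s} * ?B x" for x
  proof (cases "clique_free_map s k ?I (\<lambda>e. \<Phi> (x ` e))")
    case True
    have "?L x \<le> Q 0 s k"
      by (rule lagr_le_Q[OF k]) (use \<Phi> True m in auto)
    then show ?thesis using True by simp
  next
    case False
    \<comment> \<open>The trivial bound for a bad tuple: all s colours on every pair.\<close>
    have "?L x \<le> (\<Sum>i\<in>?I. \<Sum>j\<in>?I. 1 / real m * (1 / real m) * lg {1..s})"
      unfolding lagr_def
    proof (rule sum_mono)
      fix i
      have "(\<Sum>j\<in>?I - {i}. 1 / real m * (1 / real m) * lg (\<Phi> (x ` {i, j}))) \<le> (\<Sum>j\<in>?I - {i}. 1 / real m * (1 / real m) * lg {1..s})"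
        by (intro sum_mono mult_left_mono lg_mono \<Phi>) auto
      also have "\<dots> \<le> (\<Sum>j\<in>?I. 1 / real m * (1 / real m) * lg {1..s})"
        using lg_nonneg[of "{1..s}"] by (intro sum_mono2 mult_nonneg_nonneg) auto
      finally show "(\<Sum>j\<in>?I - {i}. 1 / real m * (1 / real m) * lg (\<Phi> (x ` {i, j}))) \<le> (\<Sum>j\<in>?I. 1 / real m * (1 / real m) * lg {1..s})" .
    qed
    also have "\<dots> = lg {1..s}" using m by simp
    finally show ?thesis using False Q_nonneg[of s k] k by simp
  qed
  \<comment> \<open>Distinct positions are independent and may hit the same vertex, so each of the m
    (m - 1) ordered pairs averages S / n^2, with the diagonal of S included.\<close>
  have "uexp ?I V ?L = (\<Sum>i\<in>?I. \<Sum>j\<in>?I - {i}. 1 / real m ^ 2 * (S / n ^ 2))"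
    unfolding lagr_def pexp_sum
  proof (intro sum.cong refl)
    fix i j assume ij: "i \<in> ?I" "j \<in> ?I - {i}"
    have "uexp ?I V (\<lambda>x. lg (\<Phi> {x i, x j})) = (\<Sum>p\<in>V. \<Sum>q\<in>V. 1 / real (card V) * (1 / real (card V)) * lg (\<Phi> {p, q}))"
      by (rule pexp_two_coordinates[where f = "\<lambda>a b. lg (\<Phi> {a, b})"]) (use ij V one in auto)
    also have "\<dots> = S / n ^ 2"
      unfolding S_def n_def sum_divide_distrib by (intro sum.cong refl) (simp add: power2_eq_square)
    finally show "uexp ?I V (\<lambda>x. 1 / real m * (1 / real m) * lg (\<Phi> (x ` {i, j}))) = 1 / real m ^ 2 * (S / n ^ 2)"
      by (simp add: pexp_cmult[of _ _ _ "1 / real m * (1 / real m)", simplified] power2_eq_square)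
  qed
  also have "\<dots> = (real m - 1) / real m * (S / n ^ 2)"
    using m by (simp add: of_nat_diff power2_eq_square)
  finally have EL: "uexp ?I V ?L = (real m - 1) / real m * (S / n ^ 2)" .
  have "uexp ?I V ?L \<le> uexp ?I V (\<lambda>x. Q 0 s k + lg {1..s} * ?B x)"
    by (rule pexp_mono) (simp, rule L_le)
  also have "\<dots> = Q 0 s k + lg {1..s} * uexp ?I V ?B"
    unfolding pexp_add pexp_cmult using V one by (simp add: pexp_const)
  also have "\<dots> \<le> Q 0 s k + lg {1..s} * \<gamma>"
    by (intro add_left_mono mult_left_mono few lg_nonneg)
  finally have "(real m - 1) / real m * (S / n ^ 2) \<le> Q 0 s k + lg {1..s} * \<gamma>"
    unfolding EL .
  then have "(real m - 1) / real m * (S / n ^ 2) * (real m * n ^ 2) \<le> (Q 0 s k + lg {1..s} * \<gamma>) * (real m * n ^ 2)"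
    using n by (intro mult_right_mono) auto
  also have "(real m - 1) / real m * (S / n ^ 2) * (real m * n ^ 2) = (real m - 1) * S"
    using n m by simp
  also have "(Q 0 s k + lg {1..s} * \<gamma>) * (real m * n ^ 2) = real m * (Q 0 s k + lg {1..s} * \<gamma>) * n ^ 2"
    by (simp only: mult_ac)
  finally show ?thesis by (simp only: S_def n_def)
qed

section \<open>Upper bound\<close>

text \<open>The terms 2 M n and s 2 ^ 4 ^ M count the partitions and the colour sets on labels. Up
  to \<delta> s n^2 edges leave the template, at log 2 (1 / z) each. The template contributes half
  of the sampled bound, and 2 z s is the cost of the weights z.\<close>

lemma F_graph_upper_bound:
  fixes k :: "nat \<Rightarrow> nat" and V :: "'a set"
  assumes k: "\<And>c. c \<in> {1..s} \<Longrightarrow> k c \<ge> 2" and V: "finite V" "V \<noteq> {}" and E: "E \<subseteq> [V]\<^bsup>2\<^esup>"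
    and m: "2 \<le> m" and \<delta>: "0 < \<delta>" "\<delta> \<le> 1" and z: "0 < z" "z \<le> 1" and "0 < \<epsilon>" and M: "real s < real M * \<epsilon>\<^sup>2"
  defines "n \<equiv> real (card V)" and "\<kappa> \<equiv> lg {1..s} * (real s * 2 ^ m * (real (m\<^sup>2) * \<epsilon> / \<delta> ^ m\<^sup>2))"
  shows "real (F_graph s k V E) \<le> 2 powr (2 * real M * n + real s * 2 ^ 4 ^ M
    + (\<delta> * real s * log 2 (1 / z) + real m / (real m - 1) * (Q 0 s k + \<kappa>) / 2 + 2 * z * real s) * n\<^sup>2)"
proof -
  let ?S = "\<lambda>\<Phi>. \<Sum>x\<in>V. \<Sum>y\<in>V. lg (\<Phi> {x, y})"
  define K where "K = real m / (real m - 1) * (Q 0 s k + \<kappa>)"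
  define b where "b = nat \<lfloor>\<delta> * real s * n\<^sup>2\<rfloor>"
  \<comment> \<open>Labels range over all sets of parts; their number does not depend on n.\<close>
  define X where "X = (V \<rightarrow>\<^sub>E {..<4 ^ M :: nat}) \<times> (Pow {..<4 ^ M :: nat} \<rightarrow>\<^sub>E Pow {1..s})"
  define T :: "('a \<Rightarrow> nat) \<times> (nat set \<Rightarrow> nat set) \<Rightarrow> 'a set \<Rightarrow> nat set" where
    "T = (\<lambda>x e. snd x (fst x ` e))"
  \<comment> \<open>Only templates of small value are kept; every valid colouring is near one of
    them.\<close>
  define Y where "Y = {x \<in> X. ?S (T x) \<le> K * n\<^sup>2}"
  define N where "N = (\<lambda>x. {\<sigma> \<in> E \<rightarrow>\<^sub>E {1..s}. card {e \<in> E. \<sigma> e \<notin> T x e} \<le> b})"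
  have finE: "finite E" using E V by (auto intro: finite_subset finite_imp_finite_nsets)
  have finX: "finite X" unfolding X_def using V by (intro finite_cartesian_product finite_PiE) auto
  then have finY: "finite Y" by (auto simp: Y_def)
  have finN: "finite (N x)" for x
    by (rule finite_subset[of _ "E \<rightarrow>\<^sub>E {1..s}"]) (auto simp: N_def intro!: finite_PiE finE)
  have T_sub: "T x e \<subseteq> {1..s}" if "x \<in> X" "e \<subseteq> V" for x e
  proof -
    have x: "fst x \<in> V \<rightarrow>\<^sub>E {..<4 ^ M}" "snd x \<in> Pow {..<4 ^ M} \<rightarrow>\<^sub>E Pow {1..s}"
      using that(1) unfolding X_def by (simp_all only: mem_Times_iff)
    have "fst x ` e \<in> Pow {..<4 ^ M}" using x(1) that(2) by auto
    then have "T x e \<in> Pow {1..s}" unfolding T_def by (rule PiE_mem[OF x(2)])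
    then show ?thesis by blast
  qed
  have cover: "valid_colourings s k V E \<subseteq> (\<Union>x\<in>Y. N x)"
  proof
    fix \<sigma> assume \<sigma>: "\<sigma> \<in> valid_colourings s k V E"
    then have \<sigma>E: "\<sigma> \<in> E \<rightarrow>\<^sub>E {1..s}" by (auto simp: valid_colourings_def)
    obtain p where p: "p \<in> V \<rightarrow>\<^sub>E {..<4 ^ M}"
      and reg: "\<And>c. c \<in> {1..s} \<Longrightarrow> cut_regular V \<epsilon> p (colour_indicator E \<sigma> c)"
      by (rule weak_regularity[OF V, of "{1..s}" \<epsilon> "colour_indicator E \<sigma>" M])
         (use \<open>0 < \<epsilon>\<close> M in \<open>auto simp: colour_indicator_range\<close>)
    define \<Psi> where "\<Psi> = dense_colours s V p (colour_indicator E \<sigma>) \<delta>"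
    define \<psi> where "\<psi> = restrict \<Psi> (Pow {..<4 ^ M})"
    have \<Psi>: "\<Psi> L \<subseteq> {1..s}" for L by (auto simp: \<Psi>_def dense_colours_def)
    have T_eq: "T (p, \<psi>) e = \<Psi> (p ` e)" if "e \<subseteq> V" for e
      using that p by (auto simp: T_def \<psi>_def)
    have "?S (T (p, \<psi>)) = ?S (\<lambda>e. \<Psi> (p ` e))"
      by (intro sum.cong refl) (simp add: T_eq)
    moreover have "(real m - 1) * ?S (\<lambda>e. \<Psi> (p ` e)) \<le> real m * (Q 0 s k + \<kappa>) * n\<^sup>2"
      unfolding n_def \<kappa>_def
    proof (rule sum_lg_template_le[OF k V])
      show "uexp {1..m} V (\<lambda>x. of_bool (\<not> clique_free_map s k {1..m} (\<lambda>e. \<Psi> (p ` x ` e))))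
          \<le> real s * 2 ^ m * (real (m\<^sup>2) * \<epsilon> / \<delta> ^ m\<^sup>2)"
        unfolding \<Psi>_def using \<open>0 < \<epsilon>\<close> by (intro template_few_cliques V E \<sigma> \<delta> reg) auto
    qed (use m \<Psi> in auto)
    ultimately have "?S (T (p, \<psi>)) \<le> K * n\<^sup>2"
      using m by (simp add: K_def field_simps)
    moreover have "(p, \<psi>) \<in> X" using p \<Psi> by (auto simp: X_def \<psi>_def)
    moreover have "\<sigma> \<in> N (p, \<psi>)"
    proof -
      have eq: "{e \<in> E. \<sigma> e \<notin> T (p, \<psi>) e} = {e \<in> E. \<sigma> e \<notin> \<Psi> (p ` e)}"
        using E T_eq by (auto simp: nsets_def)
      have "real (card {e \<in> E. \<sigma> e \<notin> \<Psi> (p ` e)}) \<le> \<delta> * real s * n\<^sup>2"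
        unfolding n_def \<Psi>_def using \<delta> by (intro template_few_exceptions V E \<sigma>E) auto
      then have "card {e \<in> E. \<sigma> e \<notin> \<Psi> (p ` e)} \<le> b" unfolding b_def by linarith
      then show ?thesis using \<sigma>E eq by (simp add: N_def)
    qed
    ultimately show "\<sigma> \<in> (\<Union>x\<in>Y. N x)" by (auto simp: Y_def)
  qed
  define U where "U = \<delta> * real s * n\<^sup>2 * log 2 (1 / z) + K * n\<^sup>2 / 2 + 2 * z * real s * n\<^sup>2"
  have cardN: "real (card (N x)) \<le> 2 powr U" if x: "x \<in> Y" for x
  proof -
    have xX: "x \<in> X" and S: "?S (T x) \<le> K * n\<^sup>2" using x by (auto simp: Y_def)
    have "real (card (N x)) \<le> 2 powr (real b * log 2 (1 / z) + (\<Sum>e\<in>E. lg (T x e)) + 2 * z * real s * real (card E))"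
      unfolding N_def using E by (intro card_near_template_powr finE z T_sub[OF xX]) (auto simp: nsets_def)
    also have "\<dots> \<le> 2 powr U"
    proof -
      have "real b \<le> \<delta> * real s * n\<^sup>2" using \<delta> by (simp add: b_def)
      then have 1: "real b * log 2 (1 / z) \<le> \<delta> * real s * n\<^sup>2 * log 2 (1 / z)"
        using z by (intro mult_right_mono) auto
      \<comment> \<open>Unordered pairs count half of the double sum, whose diagonal is nonnegative;
        hence K n^2 / 2.\<close>
      have "2 * (\<Sum>e\<in>E. lg (T x e)) \<le> 2 * (\<Sum>e\<in>[V]\<^bsup>2\<^esup>. lg (T x e))"
        using E V lg_nonneg by (intro mult_left_mono sum_mono2) (auto simp: finite_imp_finite_nsets)
      also have "\<dots> = (\<Sum>x'\<in>V. \<Sum>y\<in>V - {x'}. lg (T x {x', y}))"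
        by (rule sum_unordered_pairs[OF V(1), symmetric])
      also have "\<dots> \<le> ?S (T x)"
        using V lg_nonneg by (intro sum_mono sum_mono2) auto
      finally have 2: "(\<Sum>e\<in>E. lg (T x e)) \<le> K * n\<^sup>2 / 2" using S by linarith
      have "2 * card E \<le> 2 * card ([V]\<^bsup>2\<^esup>)"
        using E V by (intro mult_left_mono card_mono) (auto simp: finite_imp_finite_nsets)
      also have "\<dots> = card V * (card V - 1)"
        using sum_unordered_pairs[OF V(1), of "\<lambda>_. 1 :: nat"] V by (simp del: card_nsets)
      also have "\<dots> \<le> (card V)\<^sup>2"
        by (simp add: power2_eq_square)
      finally have "card E \<le> (card V)\<^sup>2" by linarith
      then have "real (card E) \<le> n\<^sup>2" unfolding n_def by (simp flip: of_nat_power)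
      then have 3: "2 * z * real s * real (card E) \<le> 2 * z * real s * n\<^sup>2"
        using z by (intro mult_left_mono) auto
      show ?thesis unfolding U_def using 1 2 3 by simp
    qed
    finally show ?thesis .
  qed
  have "real (F_graph s k V E) \<le> real (card (\<Union>x\<in>Y. N x))"
    unfolding F_graph_def of_nat_le_iff using finY finN by (intro card_mono cover) auto
  also have "\<dots> \<le> (\<Sum>x\<in>Y. real (card (N x)))"
    using card_UN_le[OF finY, of N] by (simp flip: of_nat_sum)
  also have "\<dots> \<le> real (card Y) * 2 powr U"
    using cardN by (intro sum_bounded_above)
  also have "\<dots> \<le> real (card X) * 2 powr U"
    using finX by (intro mult_right_mono) (auto simp: Y_def intro!: card_mono)
  also have "real (card X) = 2 powr (2 * real M * n + real s * 2 ^ 4 ^ M)"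
  proof -
    have "card X = (4 ^ M) ^ card V * (2 ^ s) ^ 2 ^ 4 ^ M"
      using V by (simp add: X_def card_cartesian_product card_PiE card_Pow)
    also have "real \<dots> = 2 ^ (2 * M * card V) * 2 ^ (s * 2 ^ 4 ^ M)"
      by (simp add: power_mult)
    finally show ?thesis
      by (simp add: n_def powr_add flip: powr_realpow)
  qed
  finally show ?thesis
    by (simp add: U_def K_def powr_add[symmetric] algebra_simps)
qed

text \<open>Order of choice: z, then \<delta> given z, m large against Q, \<epsilon> given \<delta>
  and m, M given \<epsilon>. With \<tau>' = \<tau> / 4, the weights and the exceptional edges cost
  \<tau>' each and the sampling costs 2 \<tau>'. The summands 1 keep the denominators
  positive.\<close>

lemma F_max_upper_bound:
  fixes k :: "nat \<Rightarrow> nat"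
  assumes k: "\<And>c. c \<in> {1..s} \<Longrightarrow> k c \<ge> 2" and "0 < \<tau>"
  obtains C where "\<And>n. 1 \<le> n \<Longrightarrow> log 2 (real (F_max s k n)) \<le> (Q 0 s k / 2 + \<tau>) * (real n)\<^sup>2 + C * real n"
proof -
  let ?Q = "Q 0 s k"
  have Q0: "0 \<le> ?Q" using Q_nonneg[of s k] k by blast
  define \<tau>' where "\<tau>' = \<tau> / 4"
  have \<tau>': "0 < \<tau>'" using \<open>0 < \<tau>\<close> by (simp add: \<tau>'_def)
  define z where "z = min 1 (\<tau>' / (2 * (real s + 1)))"
  have z: "0 < z" "z \<le> 1" using \<tau>' by (auto simp: z_def)
  have z_le: "2 * z * real s \<le> \<tau>'"
  proof -
    have "z \<le> \<tau>' / (2 * (real s + 1))" by (simp add: z_def)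
    then have "z * (2 * (real s + 1)) \<le> \<tau>'" by (subst (asm) pos_le_divide_eq) auto
    then show ?thesis using z by (simp add: algebra_simps)
  qed
  define a where "a = real s * log 2 (1 / z)"
  have a: "0 \<le> a" using z by (auto simp: a_def)
  define \<delta> where "\<delta> = min 1 (\<tau>' / (a + 1))"
  have \<delta>: "0 < \<delta>" "\<delta> \<le> 1" using \<tau>' a by (auto simp: \<delta>_def)
  have \<delta>_le: "\<delta> * real s * log 2 (1 / z) \<le> \<tau>'"
  proof -
    have "\<delta> \<le> \<tau>' / (a + 1)" by (simp add: \<delta>_def)
    then have "\<delta> * (a + 1) \<le> \<tau>'" using a by (subst (asm) pos_le_divide_eq) auto
    moreover have "\<delta> * a \<le> \<delta> * (a + 1)" using \<delta> by (intro mult_left_mono) auto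
    ultimately show ?thesis by (simp add: a_def mult.assoc)
  qed
  obtain m0 :: nat where m0: "?Q / \<tau>' < real m0" using reals_Archimedean2 by blast
  \<comment> \<open>Then Q / (m - 1) \<le> \<tau>', and m \<ge> 2 gives m / (m - 1) \<le> 2 for the
    term with \<kappa>.\<close>
  define m where "m = m0 + 2"
  have m: "2 \<le> m" by (simp add: m_def)
  define B where "B = lg {1..s} * (real s * 2 ^ m * (real (m\<^sup>2) / \<delta> ^ m\<^sup>2))"
  have B: "0 \<le> B" unfolding B_def using lg_nonneg[of "{1..s}"] \<delta> by (intro mult_nonneg_nonneg) auto
  define \<epsilon> where "\<epsilon> = \<tau>' / (B + 1)"
  have \<epsilon>: "0 < \<epsilon>" using B \<tau>' by (simp add: \<epsilon>_def)
  define \<kappa> where "\<kappa> = lg {1..s} * (real s * 2 ^ m * (real (m\<^sup>2) * \<epsilon> / \<delta> ^ m\<^sup>2))"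
  have \<kappa>B: "\<kappa> = B * \<epsilon>" by (simp add: \<kappa>_def B_def)
  have "\<epsilon> * (B + 1) = \<tau>'" using B by (simp add: \<epsilon>_def)
  then have \<kappa>: "\<kappa> \<le> \<tau>'" "0 \<le> \<kappa>" using \<epsilon> B by (auto simp: \<kappa>B algebra_simps)
  have m_le: "real m / (real m - 1) * (?Q + \<kappa>) / 2 \<le> ?Q / 2 + 2 * \<tau>'"
  proof -
    have "?Q \<le> \<tau>' * real m0" using m0 \<tau>' by (simp add: field_simps)
    also have "\<dots> \<le> \<tau>' * (real m - 1)" using \<tau>' by (simp add: m_def)
    finally have "?Q \<le> \<tau>' * (real m - 1)" .
    moreover have "real m * \<kappa> \<le> 2 * (real m - 1) * \<kappa>"
      using m \<kappa> by (intro mult_right_mono) auto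
    moreover have "2 * (real m - 1) * \<kappa> \<le> 2 * (real m - 1) * \<tau>'"
      using m \<kappa> by (intro mult_left_mono) auto
    moreover have "0 \<le> \<tau>' * (real m - 1)" using \<tau>' m by simp
    ultimately have "real m * (?Q + \<kappa>) \<le> (?Q + 4 * \<tau>') * (real m - 1)"
      by (simp add: algebra_simps)
    then have "real m / (real m - 1) * (?Q + \<kappa>) \<le> ?Q + 4 * \<tau>'" (is "?Y \<le> _")
      using m by (simp add: divide_le_eq)
    then have "?Y / 2 \<le> (?Q + 4 * \<tau>') / 2" by (rule divide_right_mono) simp
    also have "\<dots> = ?Q / 2 + 2 * \<tau>'" by simp
    finally show ?thesis .
  qed
  obtain M :: nat where "real s / \<epsilon>\<^sup>2 < real M" using reals_Archimedean2 by blast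
  then have M: "real s < real M * \<epsilon>\<^sup>2" using \<epsilon> by (simp add: divide_less_eq)
  \<comment> \<open>As n \<ge> 1, the additive constant is absorbed into the linear term.\<close>
  define C where "C = 2 * real M + real s * 2 ^ 4 ^ M"
  show ?thesis
  proof (rule that[of C])
    fix n :: nat assume n: "1 \<le> n"
    obtain E where E: "E \<subseteq> [{1..n}]\<^bsup>2\<^esup>" and F: "F_max s k n = F_graph s k {1..n} E"
      by (rule F_max_attained)
    have "real (F_max s k n) \<le> 2 powr (2 * real M * real (card {1..n}) + real s * 2 ^ 4 ^ M
      + (\<delta> * real s * log 2 (1 / z) + real m / (real m - 1) * (?Q + \<kappa>) / 2 + 2 * z * real s) * (real (card {1..n}))\<^sup>2)"
      unfolding F \<kappa>_def using n by (intro F_graph_upper_bound k E m \<delta> z \<epsilon> M) auto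
    then have "log 2 (real (F_max s k n)) \<le> 2 * real M * real n + real s * 2 ^ 4 ^ M
      + (\<delta> * real s * log 2 (1 / z) + real m / (real m - 1) * (?Q + \<kappa>) / 2 + 2 * z * real s) * (real n)\<^sup>2"
      using F_max_lower_bound(1)[of s k n] k by (simp add: log_le_iff)
    also have "\<dots> \<le> C * real n + (?Q / 2 + \<tau>) * (real n)\<^sup>2"
    proof (rule add_mono)
      have "real s * 2 ^ 4 ^ M * 1 \<le> real s * 2 ^ 4 ^ M * real n"
        using n by (intro mult_left_mono) auto
      then show "2 * real M * real n + real s * 2 ^ 4 ^ M \<le> C * real n"
        by (simp add: C_def algebra_simps)
      show "(\<delta> * real s * log 2 (1 / z) + real m / (real m - 1) * (?Q + \<kappa>) / 2 + 2 * z * real s) * (real n)\<^sup>2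
          \<le> (?Q / 2 + \<tau>) * (real n)\<^sup>2"
        using \<delta>_le m_le z_le by (intro mult_right_mono) (auto simp: \<tau>'_def)
    qed
    finally show "log 2 (real (F_max s k n)) \<le> (?Q / 2 + \<tau>) * (real n)\<^sup>2 + C * real n" by simp
  qed
qed

lemma real_choose_two: "real (n choose 2) = real n * (real n - 1) / 2"
  by (cases n) (simp_all add: choose_two real_of_nat_div field_simps)

lemma log_F_max_limit:
  fixes k :: "nat \<Rightarrow> nat"
  assumes k: "\<And>c. c \<in> {1..s} \<Longrightarrow> k c \<ge> 2"
  shows "(\<lambda>n. log 2 (real (F_max s k n)) / (real n ^ 2 / 2)) \<longlonglongrightarrow> Q 0 s k"
proof (rule LIMSEQ_I)
  fix e :: real assume e: "0 < e"
  let ?Q = "Q 0 s k"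
  let ?L = "\<lambda>n. log 2 (real (F_max s k n))"
  obtain C where C: "\<And>n. 1 \<le> n \<Longrightarrow> ?L n \<le> (?Q / 2 + e / 8) * (real n)\<^sup>2 + C * real n"
    using F_max_upper_bound[of s k "e / 8"] k e by auto
  \<comment> \<open>After division by n^2 / 2, the term e / 8 becomes e / 4. This N makes the linear
    term less than e / 2, and also Q / n, the deficit of the lower bound, less than e.\<close>
  obtain N :: nat where N: "(\<bar>C\<bar> * 4 + \<bar>?Q\<bar>) / e < real N" using reals_Archimedean2 by blast
  have "norm (?L n / (real n ^ 2 / 2) - ?Q) < e" if "max N 1 \<le> n" for n
  proof -
    have n: "real n > 0" "1 \<le> n" "real N \<le> real n" using that by auto
    have "(\<bar>C\<bar> * 4 + \<bar>?Q\<bar>) / e < real n" using N n by linarith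
    then have ne: "\<bar>C\<bar> * 4 + \<bar>?Q\<bar> < e * real n" using e by (simp add: divide_less_eq mult.commute)
    have n2: "real n ^ 2 / 2 > 0" using n by simp
    have "?L n < (?Q + e) * (real n ^ 2 / 2)"
    proof -
      have "C * 4 * real n < (e * real n) * real n"
        using ne n by (intro mult_strict_right_mono) auto
      then have "C * real n < e / 4 * real n ^ 2" by (simp add: power2_eq_square)
      moreover have "0 < e * real n ^ 2" using e n by simp
      ultimately show ?thesis using C[OF n(2)] by (simp add: algebra_simps)
    qed
    then have 1: "?L n / (real n ^ 2 / 2) < ?Q + e" using n2 by (simp only: divide_less_eq) simp
    have "(?Q - e) * (real n ^ 2 / 2) < ?L n"
    proof -
      have "?Q * real n < (e * real n) * real n"
        using ne n by (intro mult_strict_right_mono) auto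
      then have "?Q * real n < e * real n ^ 2" by (simp add: power2_eq_square)
      moreover have "?Q * real (n choose 2) = ?Q * real n ^ 2 / 2 - ?Q * real n / 2"
        by (simp add: real_choose_two field_simps power2_eq_square)
      moreover have "(?Q - e) * (real n ^ 2 / 2) = ?Q * real n ^ 2 / 2 - e * real n ^ 2 / 2"
        by (simp add: field_simps)
      ultimately have "(?Q - e) * (real n ^ 2 / 2) < ?Q * real (n choose 2)" by linarith
      also have "\<dots> \<le> ?L n" using F_max_lower_bound(2)[of s k n] k by blast
      finally show ?thesis .
    qed
    then have 2: "?Q - e < ?L n / (real n ^ 2 / 2)" using n2 by (simp only: less_divide_eq) simp
    show ?thesis using 1 2 by (simp only: real_norm_def abs_less_iff) linarith
  qed
  then show "\<exists>no. \<forall>n\<ge>no. norm (?L n / (real n ^ 2 / 2) - ?Q) < e" by blast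
qed

theorem theorem4:
  fixes s :: nat and k :: "nat \<Rightarrow> nat"
  assumes "s \<ge> 1"
    and "\<And>c. c \<in> {1..s} \<Longrightarrow> k c \<ge> 2"
  shows "(\<exists>\<epsilon> :: nat \<Rightarrow> real. \<epsilon> \<in> o(\<lambda>n. real n ^ 2) \<and>
            (\<forall>n. real (F_max s k n) = 2 powr (Q 0 s k * real (n choose 2) + \<epsilon> n))) \<and>
         (\<lambda>n. log 2 (real (F_max s k n)) / (real n ^ 2 / 2)) \<longlonglongrightarrow> Q 0 s k"
proof (intro conjI exI allI)
  let ?Q = "Q 0 s k"
  let ?L = "\<lambda>n. log 2 (real (F_max s k n))"
  let ?\<epsilon> = "\<lambda>n. ?L n - ?Q * real (n choose 2)"
  show lim: "(\<lambda>n. ?L n / (real n ^ 2 / 2)) \<longlonglongrightarrow> ?Q"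
    by (rule log_F_max_limit[OF assms(2)])
  show "real (F_max s k n) = 2 powr (?Q * real (n choose 2) + ?\<epsilon> n)" for n
    using F_max_lower_bound(1)[of s k n, OF assms(2)] by simp
  show "?\<epsilon> \<in> o(\<lambda>n. real n ^ 2)"
  proof (rule smalloI_tendsto)
    \<comment> \<open>For n > 0, (n choose 2) / n^2 = 1/2 - 1/(2 n), so the limit of the normalised
      logarithms says that the error is o(n^2).\<close>
    have "(\<lambda>n. ?L n / (real n ^ 2 / 2) / 2 - ?Q * (1 / 2 - 1 / 2 * inverse (real n))) \<longlonglongrightarrow> ?Q / 2 - ?Q * (1 / 2 - 1 / 2 * 0)"
      by (intro tendsto_intros lim lim_inverse_n) auto
    moreover have "\<forall>\<^sub>F n in sequentially. ?L n / (real n ^ 2 / 2) / 2 - ?Q * (1 / 2 - 1 / 2 * inverse (real n)) = ?\<epsilon> n / real n ^ 2"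
      using eventually_gt_at_top[of 0]
    proof eventually_elim
      case (elim n)
      then show ?case by (simp add: real_choose_two field_simps power2_eq_square)
    qed
    ultimately show "(\<lambda>n. ?\<epsilon> n / real n ^ 2) \<longlonglongrightarrow> 0"
      by (simp add: tendsto_cong)
    show "\<forall>\<^sub>F n in sequentially. real n ^ 2 \<noteq> 0"
      using eventually_gt_at_top[of 0] by eventually_elim simp
  qed
qed

end
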